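(* In the radial model problem described in the context, there exists a unique transonic solution $\varphi\in\mathcal K_1\subset W^{1,\infty}([a,R])$ to $$\sup_{a<\eta<R}\Big\{\min_{\varphi\in\mathcal K_1,\ \text{shock at } r=\eta} I(\varphi)\Big\}=\sup_{a<\eta<R}J(\eta)$$ (that is, there is exactly one $\varphi\in\mathcal K_1$, with shock at some $r=\eta\in(a,R)$, at which this sup–min value is attained) if and only if $$J'(R^-)<0\quad\text{and}\quad J'(a^+)>0 .$$
   Context: Data: $\gamma>1$, $0<a<R$, and $v_0,v_a,\rho_0,k_0>0$. Define $M_0=\rho_0v_0R$, $\hat q_0^2=v_0^2+\frac{2\gamma}{\gamma-1}k_0\rho_0^{\gamma-1}$, $c_*^2=\frac{\gamma-1}{\gamma+1}\hat q_0^2$ with $c_*,\hat q_0>0$, and $$k_a=\frac{\gamma-1}{2\gamma}\Big(\frac{a v_a}{M_0}\Big)^{\gamma-1}(\hat q_0^2-v_a^2).$$ Standing assumptions: $\gamma k_0\rho_0^{\gamma-1}<v_0^2$ (supersonic at $r=R$), $v_a<c_*$ (subsonic at $r=a$), and $k_0<k_a<\frac1\gamma\big(\frac a{M_0}\big)^{\gamma-1}c_*^{\gamma+1}$. Supersonic flow: for $a\le r\le R$, $V^{sup}(k_0,r)$ is the unique $V\in(c_*,\hat q_0)$ with $k_0=\frac{\gamma-1}{2\gamma}\big(\frac{rV}{M_0}\big)^{\gamma-1}(\hat q_0^2-V^2)$. The radial potential $\varphi^{sup}$ satisfies $\varphi^{sup}_r=V^{sup}(k_0,r)$ and $\varphi^{sup}(R)=0$.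 Also $\rho^{sup}=M_0/(rV^{sup}(k_0,r))$ and $p^{sup}=k_0(\rho^{sup})^\gamma$. Set $\mathcal K_1$: let $A_R=\{\mathbf x\in\mathbb R^2:a<|\mathbf x|<R\}$. $\mathcal K_1$ is the set of radial functions $\varphi\in W^{1,\infty}(A_R)$ for which there is an $\eta\in[a,R]$ (the shock position) such that $\varphi=\varphi^{sup}$ for $\eta\le r\le R$, $\rho\,\varphi_r\,r=M_0$ for $a\le r\le\eta$, and $\varphi(\eta)=\varphi^{sup}(\eta)$. Here, for $a\le r\le \eta$, $\rho=\big(\frac1{k_a}\frac{\gamma-1}{2\gamma}(\hat q_0^2-\varphi_r^2)\big)^{1/(\gamma-1)}$, and $\varphi_r\in(0,c_* )$ is the subsonic solution, with $\varphi_r(a)=v_a$. For each given $\eta$ this $\varphi$ is uniquely determined. "Transonic" means that the flow is supersonic ($\varphi_r>c_*$) for $r>\eta$ and subsonic ($\varphi_r<c_*$) for $r<\eta$ with $a<\eta<R$. Functional: for radial $\varphi\ge\varphi^{sup}$ with $|\nabla\varphi|\le\hat q_0$, let $c^2=\frac{\gamma-1}2(\hat q_0^2-|\nabla\varphi|^2)$, $\Omega=\{\mathbf x\in A_R:\varphi>\varphi^{sup}\}$, and $$I(\varphi)=-\int_\Omega(c^2)^{\gamma/(\gamma-1)}dx\,dy-\int_{A_R\setminus\Omega}\gamma^{\gamma/(\gamma-1)}k_a^{1/(\gamma-1)}p^{sup}\,dx\,dy+\int_{|\mathbf x|=a}\gamma^{\gamma/(\gamma-1)}k_a^{1/(\gamma-1)}\frac{M_0}{a}\,\varphi\,ds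 .$$ $J:(a,R)\to\mathbb R$ is defined by $J(\eta)=I(\varphi)$ with $\varphi\in\mathcal K_1$ the function whose shock is at $r=\eta$. $J'(a^+)$ and $J'(R^-)$ denote the one-sided limits of $J'(\eta)$ as $\eta\to a^+$ and $\eta\to R^-$. *)

theory Defs
  imports "HOL-Analysis.Analysis"
begin

type_synonym plane = "real \<times> real"

definition grad :: "('a::real_inner \<Rightarrow> real) \<Rightarrow> 'a \<Rightarrow> 'a" where
  "grad u x = (THE D. GDERIV u x :> D)"

text \<open>First-order weak derivatives, tested against compactly supported \<open>C\<^sup>1\<close> functions
  (the class of test functions in Gilbarg and Trudinger).\<close>

definition test_function :: "'a::euclidean_space set \<Rightarrow> ('a \<Rightarrow> real) \<Rightarrow> ('a \<Rightarrow> 'a) \<Rightarrow> bool" where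
  "test_function U \<psi> D\<psi> \<longleftrightarrow>
     (\<forall>x. GDERIV \<psi> x :> D\<psi> x) \<and> continuous_on UNIV D\<psi> \<and>
     (\<exists>K. compact K \<and> K \<subseteq> U \<and> (\<forall>x. x \<notin> K \<longrightarrow> \<psi> x = 0))"

definition L_infinity :: "'a::euclidean_space set \<Rightarrow> ('a \<Rightarrow> 'b::euclidean_space) \<Rightarrow> bool" where
  "L_infinity U f \<longleftrightarrow> f \<in> borel_measurable (lebesgue_on U) \<and>
     (\<exists>C. AE x in lebesgue_on U. norm (f x) \<le> C)"

definition weak_gradient :: "'a::euclidean_space set \<Rightarrow> ('a \<Rightarrow> real) \<Rightarrow> ('a \<Rightarrow> 'a) \<Rightarrow> bool" where
  "weak_gradient U u G \<longleftrightarrow> (\<forall>\<psi> D\<psi>. test_function U \<psi> D\<psi> \<longrightarrow>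
     (LINT x|lebesgue_on U. u x *\<^sub>R D\<psi> x) = - (LINT x|lebesgue_on U. \<psi> x *\<^sub>R G x))"

definition W1_infinity :: "'a::euclidean_space set \<Rightarrow> ('a \<Rightarrow> real) \<Rightarrow> bool" where
  "W1_infinity U u \<longleftrightarrow> L_infinity U u \<and> (\<exists>G. L_infinity U G \<and> weak_gradient U u G)"

text \<open>A radial function on the plane is represented by its profile in \<open>r = |x|\<close>.\<close>

definition radial :: "(real \<Rightarrow> real) \<Rightarrow> plane \<Rightarrow> real" where
  "radial \<phi> x = \<phi> (norm x)"

definition circle_integral :: "real \<Rightarrow> (plane \<Rightarrow> real) \<Rightarrow> real" where
  "circle_integral s f = (LBINT t:{0..2 * pi}. f (s * cos t, s * sin t) * s)"

locale radial_data =
  fixes \<gamma> a R v0 va \<rho>0 k0 :: real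
begin

definition M0 :: real where
  "M0 = \<rho>0 * v0 * R"

definition q_hat :: real where
  "q_hat = sqrt (v0\<^sup>2 + 2 * \<gamma> / (\<gamma> - 1) * k0 * \<rho>0 powr (\<gamma> - 1))"

definition c_star :: real where
  "c_star = sqrt ((\<gamma> - 1) / (\<gamma> + 1) * q_hat\<^sup>2)"

definition ka :: real where
  "ka = (\<gamma> - 1) / (2 * \<gamma>) * (a * va / M0) powr (\<gamma> - 1) * (q_hat\<^sup>2 - va\<^sup>2)"

definition V_sup :: "real \<Rightarrow> real \<Rightarrow> real" where
  "V_sup k r = (THE V. c_star < V \<and> V < q_hat \<and>
     k = (\<gamma> - 1) / (2 * \<gamma>) * (r * V / M0) powr (\<gamma> - 1) * (q_hat\<^sup>2 - V\<^sup>2))"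

text \<open>Profiles live on \<open>[a,R]\<close>; extensionality makes equality of profiles mean
  equality on \<open>[a,R]\<close>.  Derivatives at the end points are one-sided.\<close>

definition phi_sup :: "real \<Rightarrow> real" where
  "phi_sup = (THE \<phi>. \<phi> \<in> extensional {a..R} \<and> \<phi> R = 0 \<and>
     (\<forall>r\<in>{a..R}. (\<phi> has_real_derivative V_sup k0 r) (at r within {a..R})))"

definition rho_sup :: "real \<Rightarrow> real" where
  "rho_sup r = M0 / (r * V_sup k0 r)"

definition p_sup :: "real \<Rightarrow> real" where
  "p_sup r = k0 * rho_sup r powr \<gamma>"

definition annulus :: "plane set" where
  "annulus = {x. a < norm x \<and> norm x < R}"

text \<open>Density behind the shock at speed \<open>V\<close>.\<close>

definition rho_sub :: "real \<Rightarrow> real" where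
  "rho_sub V = (1 / ka * ((\<gamma> - 1) / (2 * \<gamma>)) * (q_hat\<^sup>2 - V\<^sup>2)) powr (1 / (\<gamma> - 1))"

text \<open>The derivative behind the shock is taken within \<open>[a,\<eta>]\<close>, hence one-sided at
  \<open>a\<close> and at the shock.\<close>

definition has_shock_at :: "real \<Rightarrow> (real \<Rightarrow> real) \<Rightarrow> bool" where
  "has_shock_at \<eta> \<phi> \<longleftrightarrow>
     (\<forall>r\<in>{\<eta>..R}. \<phi> r = phi_sup r) \<and> \<phi> \<eta> = phi_sup \<eta> \<and>
     (\<exists>V. V a = va \<and>
        (\<forall>r\<in>{a..\<eta>}. (\<phi> has_real_derivative V r) (at r within {a..\<eta>}) \<and>
           0 < V r \<and> V r < c_star \<and> rho_sub (V r) * V r * r = M0))"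

definition K1 :: "(real \<Rightarrow> real) set" where
  "K1 = {\<phi> \<in> extensional {a..R}. W1_infinity annulus (radial \<phi>) \<and>
           (\<exists>\<eta>\<in>{a..R}. has_shock_at \<eta> \<phi>)}"

definition K1_at :: "real \<Rightarrow> (real \<Rightarrow> real) set" where
  "K1_at \<eta> = {\<phi> \<in> K1. has_shock_at \<eta> \<phi>}"

definition Omega :: "(plane \<Rightarrow> real) \<Rightarrow> plane set" where
  "Omega u = {x \<in> annulus. u x > radial phi_sup x}"

definition c_squared :: "(plane \<Rightarrow> real) \<Rightarrow> plane \<Rightarrow> real" where
  "c_squared u x = (\<gamma> - 1) / 2 * (q_hat\<^sup>2 - (norm (grad u x))\<^sup>2)"

definition I :: "(plane \<Rightarrow> real) \<Rightarrow> real" where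
  "I u =
     - (LINT x|lebesgue_on (Omega u). c_squared u x powr (\<gamma> / (\<gamma> - 1)))
     - (LINT x|lebesgue_on (annulus - Omega u).
          \<gamma> powr (\<gamma> / (\<gamma> - 1)) * ka powr (1 / (\<gamma> - 1)) * p_sup (norm x))
     + circle_integral a
          (\<lambda>x. \<gamma> powr (\<gamma> / (\<gamma> - 1)) * ka powr (1 / (\<gamma> - 1)) * (M0 / a) * u x)"

definition J :: "real \<Rightarrow> real" where
  "J \<eta> = I (radial (THE \<phi>. \<phi> \<in> K1_at \<eta>))"

definition sup_min :: ereal where
  "sup_min = (SUP \<eta>\<in>{a<..<R}. INF \<phi>\<in>K1_at \<eta>. ereal (I (radial \<phi>)))"

definition transonic_at :: "real \<Rightarrow> (real \<Rightarrow> real) \<Rightarrow> bool" where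
  "transonic_at \<eta> \<phi> \<longleftrightarrow> a < \<eta> \<and> \<eta> < R \<and>
     (\<forall>r\<in>{a<..<\<eta>}. \<exists>V. (\<phi> has_real_derivative V) (at r) \<and> V < c_star) \<and>
     (\<forall>r\<in>{\<eta><..<R}. \<exists>V. (\<phi> has_real_derivative V) (at r) \<and> V > c_star)"

definition transonic_solution :: "(real \<Rightarrow> real) \<Rightarrow> bool" where
  "transonic_solution \<phi> \<longleftrightarrow> (\<exists>\<eta>. \<phi> \<in> K1_at \<eta> \<and> transonic_at \<eta> \<phi> \<and>
     (\<forall>\<psi>\<in>K1_at \<eta>. I (radial \<phi>) \<le> I (radial \<psi>)) \<and> ereal (I (radial \<phi>)) = sup_min)"

end

locale radial_model = radial_data +
  assumes gamma_gt_1: "\<gamma> > 1"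
    and a_pos: "0 < a" and a_less_R: "a < R"
    and v0_pos: "v0 > 0" and va_pos: "va > 0" and rho0_pos: "\<rho>0 > 0" and k0_pos: "k0 > 0"
    and supersonic_at_R: "\<gamma> * k0 * \<rho>0 powr (\<gamma> - 1) < v0\<^sup>2"
    and subsonic_at_a: "va < c_star"
    and k0_less_ka: "k0 < ka"
    and ka_less: "ka < 1 / \<gamma> * (a / M0) powr (\<gamma> - 1) * c_star powr (\<gamma> + 1)"

end

theory Submission
  imports Defs
begin

text \<open>
  For \<open>a \<le> \<eta> \<le> R\<close> there is exactly one profile with shock at \<open>\<eta>\<close>, so the inner minimum is the
  value \<open>J \<eta>\<close>, and different shock positions give different profiles.  Hence the first claim is
  immediate and the second one says that \<open>J\<close> has a unique maximiser in the open interval if and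
  only if its one-sided slopes at \<open>R\<close> and \<open>a\<close> are negative and positive.

  In polar coordinates \<open>J \<eta>\<close> is, up to a positive factor, the mass flux times the potential at the
  inner circle minus the integrals of \<open>r p\<close> behind and ahead of the shock.  Differentiating in \<open>\<eta>\<close>
  leaves the jump of the radial momentum flux \<open>r (p + \<rho> V\<^sup>2)\<close>, which the two conservation laws turn
  into a multiple of the jump of \<open>V + c\<^sub>*\<^sup>2 / V\<close> (\<open>J_deriv\<close>, \<open>J_slope_factor\<close>).  So \<open>J'\<close> has the sign
  of \<open>V_sub V_sup - c\<^sub>*\<^sup>2\<close> and vanishes exactly where the Prandtl relation of a normal shock holds.

  That relation holds at most once.  Both speeds carry the same mass flux through the circle, so
  the logarithm of the mass-normalised entropy constant (\<open>log_flux\<close>) has the constant jump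
  \<open>ln (k_a / k_0)\<close> between them.  A genuine normal shock from the supersonic speed \<open>s\<close> ends at the
  conjugate speed \<open>c\<^sub>*\<^sup>2 / s\<close> and has an entropy jump depending on \<open>s\<close> alone, which strictly
  increases with \<open>s\<close> (\<open>shock_entropy_jump_strict_mono\<close>); and \<open>V_sup\<close> strictly increases with the
  radius.  Comparing the two jumps, once \<open>J'\<close> is nonpositive it is negative at all larger radii
  (\<open>J_slope_single_crossing\<close>).  A one-variable argument then gives the equivalence: an interior
  maximiser is a zero of \<open>J'\<close> and forces both strict signs, while strict signs at the ends give a
  zero at which \<open>J\<close> changes from strictly increasing to strictly decreasing.

  Two facts of analysis support this: a radial function with Lipschitz, piecewise differentiable
  profile lies in \<open>W\<^sup>1\<^sup>,\<^sup>\<infinity>\<close>, so that the shock profiles are admissible, and the polar formula for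
  integrals of radial functions.
\<close>

section \<open>Lipschitz functions and weak gradients\<close>

text \<open>Translation invariance of the Lebesgue measure makes every difference quotient of \<open>w\<close> integrate to
  zero.  The Lipschitz constant times the indicator of a slightly larger ball dominates the
  quotients, so dominated convergence passes this on to the derivative; points of a null set
  where \<open>w\<close> is not differentiable do no harm.\<close>

lemma integral_gradient_compact_support:
  fixes w :: "'a::euclidean_space \<Rightarrow> real"
  assumes lip: "L-lipschitz_on UNIV w"
    and supp: "\<And>x. x \<notin> cball 0 B \<Longrightarrow> w x = 0"
    and meas: "D \<in> borel_measurable borel"
    and grad: "AE x in lborel. GDERIV w x :> D x"
  shows "integrable lborel D" and "(LINT x|lborel. D x) = 0"
proof -
  have L0: "0 \<le> L"
    using lip lipschitz_on_nonneg by blast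
  have w_cont: "continuous_on UNIV w"
    using lip lipschitz_on_continuous_on by blast
  have w_int: "integrable lborel w"
  proof -
    have "integrable lborel (\<lambda>x. indicator (cball 0 B) x *\<^sub>R w x)"
      by (intro borel_integrable_compact) (auto intro: continuous_on_subset[OF w_cont])
    moreover have "(\<lambda>x. indicator (cball 0 B) x *\<^sub>R w x) = w"
      using supp by (intro ext) (auto simp: indicator_def)
    ultimately show ?thesis by simp
  qed
  have component: "integrable lborel (\<lambda>x. D x \<bullet> e) \<and> (LINT x|lborel. D x \<bullet> e) = 0"
    if e: "e \<in> Basis" for e :: 'a
  proof -
    define h :: "nat \<Rightarrow> real" where "h n = 1 / real (Suc n)" for n
    have h: "0 < h n" "h n \<le> 1" for n
      by (auto simp: h_def)
    have h_lim: "h \<longlonglongrightarrow> 0"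
      unfolding h_def using LIMSEQ_inverse_real_of_nat by (simp add: inverse_eq_divide)
    define q where "q n x = (w (h n *\<^sub>R e + x) - w x) / h n" for n x
    have norm_he: "norm (h n *\<^sub>R e) = h n" for n
      using h[of n] e by simp
    have w_meas: "w \<in> borel_measurable borel"
      by (rule borel_measurable_continuous_onI[OF w_cont])
    have q_meas: "q n \<in> borel_measurable lborel" for n
      unfolding q_def using w_meas by measurable
    have shift_int: "integrable lborel (\<lambda>x. w (c + x))"
      and shift: "(LINT x|lborel. w (c + x)) = (LINT x|lborel. w x)" for c
    proof -
      have "integrable (distr lborel borel ((+) c)) w"
        using w_int by (simp add: lborel_distr_plus)
      then show "integrable lborel (\<lambda>x. w (c + x))"
        by (subst (asm) integrable_distr_eq) (use w_meas in auto)
      have "(LINT x|lborel. w x) = (LINT x|distr lborel borel ((+) c). w x)"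
        by (simp add: lborel_distr_plus)
      also have "\<dots> = (LINT x|lborel. w (c + x))"
        by (rule integral_distr) (use w_meas in auto)
      finally show "(LINT x|lborel. w (c + x)) = (LINT x|lborel. w x)" ..
    qed
    have q_zero: "(LINT x|lborel. q n x) = 0" for n
      unfolding q_def using shift_int[of "h n *\<^sub>R e"] w_int shift[of "h n *\<^sub>R e"]
      by simp
    have q_bound: "norm (q n x) \<le> L * indicator (cball 0 (B + 1)) x" for n x
    proof (cases "x \<in> cball 0 (B + 1)")
      case True
      have "\<bar>w (h n *\<^sub>R e + x) - w x\<bar> \<le> L * h n"
        using lipschitz_onD[OF lip, of "h n *\<^sub>R e + x" x] norm_he[of n]
        by (simp add: dist_norm)
      then show ?thesis
        using True h[of n] by (simp add: q_def field_simps)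
    next
      case False
      then have "B + 1 < norm x" by simp
      moreover have "norm x \<le> norm (h n *\<^sub>R e + x) + h n"
        using norm_triangle_ineq4[of "h n *\<^sub>R e + x" "h n *\<^sub>R e"] norm_he[of n] by simp
      ultimately have "w x = 0" "w (h n *\<^sub>R e + x) = 0"
        using h[of n] by (intro supp; simp)+
      then show ?thesis using L0 by (simp add: q_def)
    qed
    have dominating: "integrable lborel (\<lambda>x::'a. L * indicator (cball 0 (B + 1)) x)"
      using borel_integrable_compact[of "cball 0 (B + 1)" "\<lambda>_::'a. 1::real"] by simp
    have q_lim: "AE x in lborel. (\<lambda>n. q n x) \<longlonglongrightarrow> D x \<bullet> e"
      using grad
    proof eventually_elim
      case (elim x)
      have "((\<lambda>t. w (t *\<^sub>R e + x)) has_real_derivative e \<bullet> D x) (at 0)"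
      proof -
        have "((\<lambda>t. t *\<^sub>R e + x) has_derivative (\<lambda>t. t *\<^sub>R e)) (at 0)"
          by (auto intro!: derivative_eq_intros)
        moreover have "(w has_derivative (\<lambda>k. k \<bullet> D x)) (at (0 *\<^sub>R e + x))"
          using elim by (simp add: gderiv_def)
        ultimately have "((\<lambda>t. w (t *\<^sub>R e + x)) has_derivative (\<lambda>t. (t *\<^sub>R e) \<bullet> D x)) (at 0)"
          by (rule has_derivative_compose)
        then show ?thesis
          by (simp add: has_field_derivative_def mult.commute[of _ "e \<bullet> D x"])
      qed
      then have "((\<lambda>t. (w (t *\<^sub>R e + x) - w x) / t) \<longlongrightarrow> e \<bullet> D x) (at 0)"
        by (simp add: has_field_derivative_iff)
      moreover have "filterlim h (at 0) sequentially"
        unfolding filterlim_at using h_lim h by (auto simp: less_le)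
      ultimately show ?case
        unfolding q_def inner_commute[of "D x"] by (rule filterlim_compose)
    qed
    have D_meas: "(\<lambda>x. D x \<bullet> e) \<in> borel_measurable lborel"
      using meas by simp
    have int: "integrable lborel (\<lambda>x. D x \<bullet> e)"
      by (rule integrable_dominated_convergence[OF D_meas q_meas dominating q_lim])
        (use q_bound in auto)
    have "(\<lambda>n. LINT x|lborel. q n x) \<longlonglongrightarrow> (LINT x|lborel. D x \<bullet> e)"
      by (rule integral_dominated_convergence[OF D_meas q_meas dominating q_lim])
        (use q_bound in auto)
    then have "(LINT x|lborel. D x \<bullet> e) = 0"
      by (simp add: q_zero LIMSEQ_const_iff)
    with int show ?thesis by blast
  qed
  have "integrable lborel (\<lambda>x. \<Sum>e\<in>Basis. (D x \<bullet> e) *\<^sub>R e)"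
    using component by (intro Bochner_Integration.integrable_sum) auto
  then show D_int: "integrable lborel D"
    by (simp add: euclidean_representation)
  show "(LINT x|lborel. D x) = 0"
  proof (rule euclidean_eqI)
    fix e :: 'a assume "e \<in> Basis"
    then show "(LINT x|lborel. D x) \<bullet> e = 0 \<bullet> e"
      using component[of e] D_int by (simp add: integral_inner_left)
  qed
qed

lemma lborel_integral_supported:
  fixes f :: "'a::euclidean_space \<Rightarrow> 'b::euclidean_space"
  assumes "U \<in> sets lebesgue" "f \<in> borel_measurable borel" "\<And>x. x \<notin> U \<Longrightarrow> f x = 0"
  shows "(LINT x|lebesgue_on U. f x) = (LINT x|lborel. f x)"
proof -
  have "(LINT x|lebesgue_on U. f x) = (LINT x|lebesgue. indicator U x *\<^sub>R f x)"
    using assms(1) by (intro integral_restrict_space) auto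
  also have "\<dots> = (LINT x|lebesgue. f x)"
    using assms(3) by (intro Bochner_Integration.integral_cong) (auto simp: indicator_def)
  also have "\<dots> = (LINT x|lborel. f x)"
    using assms(2) by (intro integral_completion) auto
  finally show ?thesis .
qed

lemma GDERIV_unique:
  assumes "GDERIV f x :> D" "GDERIV f x :> E"
  shows "D = E"
proof -
  have "(\<lambda>h. h \<bullet> D) = (\<lambda>h. h \<bullet> E)"
    using assms unfolding gderiv_def by (rule has_derivative_unique)
  then show ?thesis
    by (metis inner_commute vector_eq_rdot)
qed

lemma GDERIV_zero_outside:
  assumes "closed K" "x \<notin> K" "\<And>y. y \<notin> K \<Longrightarrow> f y = 0"
  shows "GDERIV f x :> 0"
proof -
  have "((\<lambda>_. 0::real) has_derivative (\<lambda>h. h \<bullet> 0)) (at x)"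
    by simp
  moreover have "open (- K)" "x \<in> - K"
    using assms by (auto simp: open_Compl)
  ultimately show ?thesis
    unfolding gderiv_def
    by (rule has_derivative_transform_within_open) (simp add: assms(3))
qed

lemma test_function_facts:
  assumes "test_function U \<psi> D\<psi>"
  obtains K M where "compact K" "K \<subseteq> U" "\<And>x. x \<notin> K \<Longrightarrow> \<psi> x = 0" "\<And>x. x \<notin> K \<Longrightarrow> D\<psi> x = 0"
    "M-lipschitz_on UNIV \<psi>" "\<And>x. \<bar>\<psi> x\<bar> \<le> M" "0 \<le> M" "continuous_on UNIV \<psi>"
proof -
  obtain K where K: "compact K" "K \<subseteq> U" and \<psi>0: "\<And>x. x \<notin> K \<Longrightarrow> \<psi> x = 0"
    and \<psi>: "\<And>x. GDERIV \<psi> x :> D\<psi> x" and D\<psi>_cont: "continuous_on UNIV D\<psi>"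
    using assms unfolding test_function_def by blast
  have D\<psi>0: "D\<psi> x = 0" if "x \<notin> K" for x
    using GDERIV_unique[OF \<psi> GDERIV_zero_outside[OF compact_imp_closed[OF K(1)] that \<psi>0]] by simp
  have \<psi>_cont: "continuous_on UNIV \<psi>"
    using \<psi> unfolding gderiv_def
    by (intro continuous_at_imp_continuous_on ballI) (auto dest: has_derivative_continuous)
  have "bounded (D\<psi> ` K)" "bounded (\<psi> ` K)"
    using K(1) by (auto intro!: compact_imp_bounded compact_continuous_image
        intro: continuous_on_subset[OF D\<psi>_cont] continuous_on_subset[OF \<psi>_cont])
  then obtain M1 M2 where M1: "\<And>x. x \<in> K \<Longrightarrow> norm (D\<psi> x) \<le> M1" 
    and M2: "\<And>x. x \<in> K \<Longrightarrow> \<bar>\<psi> x\<bar> \<le> M2"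
    unfolding bounded_iff by auto
  define M where "M = max 0 (max M1 M2)"
  have M: "norm (D\<psi> x) \<le> M" "\<bar>\<psi> x\<bar> \<le> M" for x
    using M1[of x] M2[of x] D\<psi>0[of x] \<psi>0[of x] by (cases "x \<in> K"; auto simp: M_def)+
  have "M-lipschitz_on UNIV \<psi>"
  proof (rule lipschitz_onI)
    fix x y
    have "norm (\<psi> x - \<psi> y) \<le> M * norm (x - y)"
    proof (rule differentiable_bound[where S = UNIV and f' = "\<lambda>x h. h \<bullet> D\<psi> x"])
      show "(\<psi> has_derivative (\<lambda>h. h \<bullet> D\<psi> z)) (at z within UNIV)" for z
        using \<psi>[of z] by (simp add: gderiv_def)
      show "onorm (\<lambda>h. h \<bullet> D\<psi> z) \<le> M" for z
      proof (rule onorm_le)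
        fix h
        have "norm (h \<bullet> D\<psi> z) \<le> norm h * norm (D\<psi> z)"
          using Cauchy_Schwarz_ineq2 by auto
        also have "\<dots> \<le> M * norm h"
          using M(1)[of z] mult_left_mono[of "norm (D\<psi> z)" M "norm h"] by (simp add: mult.commute)
        finally show "norm (h \<bullet> D\<psi> z) \<le> M * norm h" .
      qed
    qed auto
    then show "dist (\<psi> x) (\<psi> y) \<le> M * dist x y"
      by (simp add: dist_norm)
  qed (simp add: M_def)
  then show thesis
    using that K \<psi>0 D\<psi>0 M(2) \<psi>_cont by (simp add: M_def)
qed

text \<open>Apply the preceding result to \<open>u \<psi>\<close>.  This product is Lipschitz on the whole space although \<open>u\<close>
  is controlled only on \<open>U\<close>: if one of two points lies outside the support of \<open>\<psi>\<close>, only the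
  increment of \<open>\<psi>\<close> contributes, multiplied by the value of \<open>u\<close> at the other point.\<close>

lemma lipschitz_weak_gradient:
  fixes u :: "'a::euclidean_space \<Rightarrow> real"
  assumes U: "open U"
    and lip: "L-lipschitz_on U u"
    and meas: "G \<in> borel_measurable borel"
    and grad: "AE x in lborel. x \<in> U \<longrightarrow> GDERIV u x :> G x"
  shows "weak_gradient U u G"
  unfolding weak_gradient_def
proof (intro allI impI)
  fix \<psi> D\<psi> assume test: "test_function U \<psi> D\<psi>"
  then obtain K M where K: "compact K" "K \<subseteq> U"
    and \<psi>0: "\<And>x. x \<notin> K \<Longrightarrow> \<psi> x = 0" and D\<psi>0: "\<And>x. x \<notin> K \<Longrightarrow> D\<psi> x = 0"
    and \<psi>_lip: "M-lipschitz_on UNIV \<psi>" and \<psi>_bound: "\<And>x. \<bar>\<psi> x\<bar> \<le> M" and M: "0 \<le> M"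
    and \<psi>_cont: "continuous_on UNIV \<psi>"
    using test_function_facts by blast
  have \<psi>: "GDERIV \<psi> x :> D\<psi> x" and D\<psi>_cont: "continuous_on UNIV D\<psi>" for x
    using test unfolding test_function_def by blast+
  have L0: "0 \<le> L"
    using lip lipschitz_on_nonneg by blast
  have u_cont: "continuous_on U u"
    using lip lipschitz_on_continuous_on by blast
  have "bounded (u ` K)"
    using K by (auto intro!: compact_imp_bounded compact_continuous_image
        intro: continuous_on_subset[OF u_cont])
  then obtain N0 where "\<And>x. x \<in> K \<Longrightarrow> \<bar>u x\<bar> \<le> N0"
    unfolding bounded_iff by auto
  then obtain N where N: "\<And>x. x \<in> K \<Longrightarrow> \<bar>u x\<bar> \<le> N" "0 \<le> N"
    by (meson abs_ge_zero max.cobounded1 max.cobounded2 order_trans)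
  define w where "w x = u x * \<psi> x" for x
  have w0: "w x = 0" if "x \<notin> K" for x
    using that \<psi>0 by (simp add: w_def)
  \<comment> \<open>Enough by symmetry: if both points are off the support there is nothing to prove.\<close>
  have half: "\<bar>w x - w y\<bar> \<le> (N * M + M * L) * dist x y" if x: "x \<in> K" for x y
  proof (cases "y \<in> K")
    case True
    have "w x - w y = u x * (\<psi> x - \<psi> y) + \<psi> y * (u x - u y)"
      by (simp add: w_def algebra_simps)
    also have "\<bar>\<dots>\<bar> \<le> \<bar>u x\<bar> * \<bar>\<psi> x - \<psi> y\<bar> + \<bar>\<psi> y\<bar> * \<bar>u x - u y\<bar>"
      by (metis abs_mult abs_triangle_ineq)
    also have "\<dots> \<le> N * (M * dist x y) + M * (L * dist x y)"
      using N x \<psi>_bound M lipschitz_onD[OF \<psi>_lip, of x y] lipschitz_onD[OF lip, of x y] True K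
      by (intro add_mono mult_mono) (auto simp: dist_real_def)
    finally show ?thesis by (simp add: algebra_simps)
  next
    case False
    have "\<bar>w x - w y\<bar> = \<bar>u x\<bar> * \<bar>\<psi> x - \<psi> y\<bar>"
      using False \<psi>0 by (simp add: w_def abs_mult)
    also have "\<dots> \<le> N * (M * dist x y)"
      using N x lipschitz_onD[OF \<psi>_lip, of x y] by (intro mult_mono) (auto simp: dist_real_def)
    also have "\<dots> \<le> (N * M + M * L) * dist x y"
      using M L0 by (simp add: algebra_simps)
    finally show ?thesis .
  qed
  have w_lip: "(N * M + M * L)-lipschitz_on UNIV w"
  proof (rule lipschitz_onI)
    fix x y
    show "dist (w x) (w y) \<le> (N * M + M * L) * dist x y"
    proof (cases "x \<in> K \<or> y \<in> K")
      case True
      then show ?thesis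
        using half[of x y] half[of y x]
        by (auto simp: dist_real_def abs_minus_commute dist_commute)
    qed (use w0 N M L0 in simp)
  qed (use N M L0 in simp)
  obtain B where B: "K \<subseteq> cball 0 B"
    using compact_imp_bounded[OF K(1)] unfolding bounded_iff by (auto simp: subset_eq)
  \<comment> \<open>The indicator changes no value, but it makes measurability and integrability evident.\<close>
  define A where "A x = indicator K x *\<^sub>R (u x *\<^sub>R D\<psi> x)" for x
  have A_eq: "A x = u x *\<^sub>R D\<psi> x" for x
    using D\<psi>0 by (auto simp: A_def indicator_def)
  have A_int: "integrable lborel A"
    unfolding A_def using K
    by (intro borel_integrable_compact continuous_on_scaleR)
      (auto intro: continuous_on_subset[OF u_cont] continuous_on_subset[OF D\<psi>_cont])
  then have A_meas: "A \<in> borel_measurable borel"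
    by auto
  define E where "E x = \<psi> x *\<^sub>R G x" for x
  have E_meas: "E \<in> borel_measurable borel"
    unfolding E_def using meas borel_measurable_continuous_onI[OF \<psi>_cont] by measurable
  have w_grad: "AE x in lborel. GDERIV w x :> A x + E x"
    using grad
  proof eventually_elim
    case (elim x)
    show ?case
    proof (cases "x \<in> K")
      case True
      then have "GDERIV u x :> G x" using elim K by blast
      from GDERIV_mult[OF this \<psi>] show ?thesis
        by (simp add: w_def[abs_def] A_eq E_def)
    next
      case False
      then show ?thesis
        using GDERIV_zero_outside[OF compact_imp_closed[OF K(1)] False w0]
        by (simp add: A_eq D\<psi>0 E_def \<psi>0)
    qed
  qed
  have AE_meas: "(\<lambda>x. A x + E x) \<in> borel_measurable borel"
    using A_meas E_meas by measurable
  have w_supp: "w x = 0" if "x \<notin> cball 0 B" for x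
    using that B w0 by blast
  note zero = integral_gradient_compact_support[OF w_lip w_supp AE_meas w_grad]
  have E_int: "integrable lborel E"
    using Bochner_Integration.integrable_diff[OF zero(1) A_int] by simp
  have "(LINT x|lborel. A x) = - (LINT x|lborel. E x)"
    using zero(2) A_int E_int by (simp add: add_eq_0_iff2)
  moreover have A_outside: "A x = 0" if "x \<notin> U" for x
    using that K D\<psi>0 by (auto simp: A_eq)
  moreover have "(LINT x|lebesgue_on U. A x) = (LINT x|lborel. A x)"
    using U A_meas A_outside by (intro lborel_integral_supported) auto
  moreover have E_outside: "E x = 0" if "x \<notin> U" for x
    using that K \<psi>0 by (auto simp: E_def)
  moreover have "(LINT x|lebesgue_on U. E x) = (LINT x|lborel. E x)"
    using U E_meas E_outside by (intro lborel_integral_supported) auto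
  ultimately show "(LINT x|lebesgue_on U. u x *\<^sub>R D\<psi> x) = - (LINT x|lebesgue_on U. \<psi> x *\<^sub>R G x)"
    by (simp add: A_eq E_def)
qed

lemma lipschitz_W1_infinity:
  fixes u :: "'a::euclidean_space \<Rightarrow> real"
  assumes U: "open U" "bounded U"
    and lip: "L-lipschitz_on U u"
    and meas: "G \<in> borel_measurable borel"
    and bound: "\<And>x. norm (G x) \<le> C"
    and grad: "AE x in lborel. x \<in> U \<longrightarrow> GDERIV u x :> G x"
  shows "W1_infinity U u"
  unfolding W1_infinity_def
proof (intro conjI exI)
  have "bounded (u ` U)"
    using lip U(2) lipschitz_on_uniformly_continuous bounded_uniformly_continuous_image by blast
  then obtain B where "\<And>x. x \<in> U \<Longrightarrow> \<bar>u x\<bar> \<le> B"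
    unfolding bounded_iff by auto
  moreover have "u \<in> borel_measurable (lebesgue_on U)"
    using lip U(1) by (intro continuous_imp_measurable_on_sets_lebesgue lipschitz_on_continuous_on) auto
  ultimately show "L_infinity U u"
    unfolding L_infinity_def by (auto intro!: exI[of _ B] AE_I2)
  have "G \<in> borel_measurable (lebesgue_on U)"
    using meas by (simp add: borel_measurable_if_D measurable_restrict_space1 measurable_completion)
  then show "L_infinity U G"
    unfolding L_infinity_def using bound by blast
  show "weak_gradient U u G"
    by (rule lipschitz_weak_gradient[OF U(1) lip meas grad])
qed

section \<open>Radial functions on the plane\<close>

lemma GDERIV_radial:
  fixes x :: plane
  assumes "x \<noteq> 0" "(\<phi> has_real_derivative d) (at (norm x))"
  shows "GDERIV (radial \<phi>) x :> d *\<^sub>R sgn x"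
  using GDERIV_DERIV_compose[OF GDERIV_norm[OF assms(1)] assms(2)]
  by (simp add: radial_def[abs_def])

lemma grad_radial:
  assumes "x \<noteq> 0" "(\<phi> has_real_derivative d) (at (norm x))"
  shows "norm (grad (radial \<phi>) x) = \<bar>d\<bar>"
proof -
  have "grad (radial \<phi>) x = d *\<^sub>R sgn x"
    unfolding grad_def using GDERIV_radial[OF assms] GDERIV_unique by blast
  then show ?thesis
    using assms(1) by (simp add: norm_sgn)
qed

lemma circle_null_set: "sphere (0::plane) s \<in> null_sets lborel"
  using negligible_sphere[of "0::plane" s]
  by (auto simp: null_sets_completion_iff negligible_iff_null_sets)

text \<open>The finitely many corners of the profile become circles in the plane, which are null sets.\<close>

lemma radial_W1_infinity:
  assumes a: "0 \<le> a"
    and lip: "L-lipschitz_on {a<..<b} \<phi>"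
    and S: "finite S"
    and deriv: "\<And>r. r \<in> {a<..<b} - S \<Longrightarrow> (\<phi> has_real_derivative D r) (at r)"
    and meas: "D \<in> borel_measurable borel"
    and bound: "\<And>r. \<bar>D r\<bar> \<le> C"
  shows "W1_infinity {x. a < norm x \<and> norm x < b} (radial \<phi>)"
proof (rule lipschitz_W1_infinity)
  let ?U = "{x::plane. a < norm x \<and> norm x < b}"
  show "open ?U"
    by (intro open_Collect_conj open_Collect_less continuous_intros)
  show "bounded ?U"
    by (rule bounded_subset[of "ball 0 b"]) auto
  show "L-lipschitz_on ?U (radial \<phi>)"
  proof (rule lipschitz_onI)
    fix x y assume "x \<in> ?U" "y \<in> ?U"
    then have "dist (radial \<phi> x) (radial \<phi> y) \<le> L * dist (norm x) (norm y)"
      unfolding radial_def by (intro lipschitz_onD[OF lip]) auto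
    also have "\<dots> \<le> L * dist x y"
      using lipschitz_on_nonneg[OF lip] norm_triangle_ineq3[of x y]
      by (intro mult_left_mono) (auto simp: dist_norm)
    finally show "dist (radial \<phi> x) (radial \<phi> y) \<le> L * dist x y" .
  qed (rule lipschitz_on_nonneg[OF lip])
  show "(\<lambda>x::plane. D (norm x) *\<^sub>R sgn x) \<in> borel_measurable borel"
    using meas unfolding sgn_div_norm by measurable
  show "norm (D (norm x) *\<^sub>R sgn x) \<le> C" for x :: plane
    using bound[of "norm x"] bound[of 0] by (cases "x = 0") (auto simp: norm_sgn)
  show "AE x in lborel. x \<in> ?U \<longrightarrow> GDERIV (radial \<phi>) x :> D (norm x) *\<^sub>R sgn x"
  proof (rule AE_I')
    show "(\<Union>s\<in>S. sphere (0::plane) s) \<in> null_sets lborel"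
      using S by (intro null_sets_UN') (auto intro: countable_finite circle_null_set)
    show "{x \<in> space lborel. \<not> (x \<in> ?U \<longrightarrow> GDERIV (radial \<phi>) x :> D (norm x) *\<^sub>R sgn x)}
        \<subseteq> (\<Union>s\<in>S. sphere 0 s)"
    proof clarsimp
      fix u v assume *: "a < norm (u, v)" "norm (u, v) < b"
        "\<not> GDERIV (radial \<phi>) (u, v) :> D (norm (u, v)) *\<^sub>R sgn (u, v)"
      show "norm (u, v) \<in> S"
      proof (rule ccontr)
        assume "norm (u, v) \<notin> S"
        then have "(\<phi> has_real_derivative D (norm (u, v))) (at (norm (u, v)))"
          using * by (intro deriv) auto
        moreover have "(u, v) \<noteq> 0" using * a by auto
        ultimately show False using GDERIV_radial * by blast
      qed
    qed
  qed
qed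

lemma emeasure_disc:
  assumes "0 \<le> r"
  shows "emeasure lborel (ball (0::plane) r) = ennreal (pi * r\<^sup>2)"
    and "emeasure lborel (cball (0::plane) r) = ennreal (pi * r\<^sup>2)"
  using emeasure_ball[OF assms, of "0::plane"] emeasure_cball[OF assms, of "0::plane"]
    unit_ball_vol_even[of 1] by (simp_all add: power2_eq_square)

lemma emeasure_annulus:
  assumes "0 \<le> s" "s \<le> b"
  shows "emeasure lborel {x::plane. s < norm x \<and> norm x < b} = ennreal (pi * b\<^sup>2 - pi * s\<^sup>2)"
proof (cases "s = b")
  case True
  then have empty: "{x::plane. s < norm x \<and> norm x < b} = {}" by auto
  show ?thesis unfolding empty by (simp add: True)
next
  case False
  have "{x::plane. s < norm x \<and> norm x < b} = ball 0 b - cball 0 s"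
    by auto
  also have "emeasure lborel \<dots> = emeasure lborel (ball (0::plane) b) - emeasure lborel (cball (0::plane) s)"
    using False assms emeasure_disc(2)[of s] by (intro emeasure_Diff) auto
  also have "\<dots> = ennreal (pi * b\<^sup>2 - pi * s\<^sup>2)"
    using assms by (simp add: emeasure_disc ennreal_minus)
  finally show ?thesis .
qed

text \<open>Polar coordinates without a change of variables: the image of the planar measure under the norm
  is determined by its values on half-lines, and these are the areas of annuli.\<close>

lemma distr_norm_annulus:
  assumes "0 \<le> a" "a \<le> b"
  shows "distr (restrict_space lborel {x::plane. a < norm x \<and> norm x < b}) borel norm
    = density lborel (\<lambda>r. ennreal (2 * pi * r * indicator {a..b} r))"
    (is "?M = ?N")
proof (rule measure_eqI_lessThan)
  let ?U = "{x::plane. a < norm x \<and> norm x < b}"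
  have U: "?U \<in> sets borel" by measurable
  have *: "emeasure ?M {t<..} = ennreal (pi * b\<^sup>2 - pi * (min b (max a t))\<^sup>2)" for t
  proof -
    have "emeasure ?M {t<..} = emeasure (restrict_space lborel ?U) (norm -` {t<..} \<inter> ?U)"
      using U by (subst emeasure_distr) (auto simp: space_restrict_space measurable_restrict_space1)
    also have "\<dots> = emeasure lborel (norm -` {t<..} \<inter> ?U)"
      using U by (intro emeasure_restrict_space) auto
    also have "norm -` {t<..} \<inter> ?U = {x. min b (max a t) < norm x \<and> norm x < b}"
      by (auto simp: min_def max_def split: if_splits)
    also have "emeasure lborel \<dots> = ennreal (pi * b\<^sup>2 - pi * (min b (max a t))\<^sup>2)"
      using assms by (intro emeasure_annulus) auto
    finally show ?thesis .
  qed
  show "emeasure ?M {t<..} < \<infinity>" for t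
    by (simp add: *)
  show "emeasure ?M {t<..} = emeasure ?N {t<..}" for t
  proof -
    let ?s = "min b (max a t)"
    have "emeasure ?N {t<..} = (\<integral>\<^sup>+r. ennreal (2 * pi * r * indicator {a..b} r) * indicator {t<..} r \<partial>lborel)"
      by (intro emeasure_density) auto
    also have "\<dots> = (\<integral>\<^sup>+r. ennreal (2 * pi * r) * indicator {?s..b} r \<partial>lborel)"
    proof (rule nn_integral_cong_AE)
      \<comment> \<open>The integrands may differ at the left end, as the half-line is open there.\<close>
      show "AE r in lborel. ennreal (2 * pi * r * indicator {a..b} r) * indicator {t<..} r
          = ennreal (2 * pi * r) * indicator {?s..b} r"
        using AE_lborel_singleton[of ?s]
        by eventually_elim (auto simp: indicator_def min_def max_def split: if_splits)
    qed
    also have "\<dots> = ennreal (pi * b\<^sup>2 - pi * ?s\<^sup>2)"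
      using assms by (intro nn_integral_FTC_Icc)
        (auto intro!: derivative_eq_intros simp: power2_eq_square)
    finally show ?thesis by (simp add: *)
  qed
qed auto

text \<open>The set \<open>A\<close> may contain any part of the boundary circles, because the complement in the annulus
  of the region behind the shock contains the shock circle.\<close>

lemma integral_radial_annulus:
  assumes "0 \<le> a" "a \<le> b" and cont: "continuous_on {a..b} f"
    and A: "A \<in> sets borel" "{x::plane. a < norm x \<and> norm x < b} \<subseteq> A" "A \<subseteq> {x. a \<le> norm x \<and> norm x \<le> b}"
  shows "(LINT x|lebesgue_on A. f (norm x)) = 2 * pi * integral {a..b} (\<lambda>r. r * f r)"
proof -
  let ?U = "{x::plane. a < norm x \<and> norm x < b}"
  have U: "?U \<in> sets borel" by measurable
  \<comment> \<open>Continuity of \<open>f\<close> on the interval gives Borel measurability only after extension by zero.\<close>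
  define g where "g r = indicat_real {a..b} r *\<^sub>R f r" for r
  have g_meas: "g \<in> borel_measurable borel"
    unfolding g_def by (intro borel_measurable_continuous_on_indicator cont) auto
  have "(\<lambda>x::plane. g (norm x)) \<in> borel_measurable borel"
    by (rule measurable_compose[OF _ g_meas]) simp
  then have gn_meas: "(\<lambda>x::plane. indicator S x *\<^sub>R g (norm x)) \<in> borel_measurable borel"
    if "S \<in> sets borel" for S
    using that by (intro borel_measurable_scaleR borel_measurable_indicator)
  have "(LINT x|lebesgue_on A. f (norm x)) = (LINT x|lebesgue. indicator A x *\<^sub>R f (norm x))"
    using A by (intro integral_restrict_space) auto
  also have "\<dots> = (LINT x|lebesgue. indicator A x *\<^sub>R g (norm x))"
    using A(3) by (intro Bochner_Integration.integral_cong) (auto simp: indicator_def g_def)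
  also have "\<dots> = (LINT x|lborel. indicator A x *\<^sub>R g (norm x))"
    using gn_meas[OF A(1)] by (intro integral_completion) simp
  also have "\<dots> = (LINT x|lborel. indicator ?U x *\<^sub>R g (norm x))"
  proof (rule integral_cong_AE)
    have "AE x in lborel. x \<notin> sphere (0::plane) a" "AE x in lborel. x \<notin> sphere (0::plane) b"
      by (intro AE_not_in circle_null_set)+
    then show "AE x in lborel. indicator A x *\<^sub>R g (norm x) = indicator ?U x *\<^sub>R g (norm x)"
    proof eventually_elim
      case (elim x)
      then have "x \<in> A \<longleftrightarrow> x \<in> ?U" using A(2,3) by force
      then show ?case by (simp add: indicator_def)
    qed
  qed (use gn_meas[OF A(1)] gn_meas[OF U] in simp_all)
  also have "\<dots> = (LINT x|restrict_space lborel ?U. g (norm x))"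
    using U by (intro integral_restrict_space[symmetric]) auto
  also have "\<dots> = (LINT r|distr (restrict_space lborel ?U) borel norm. g r)"
    using g_meas by (intro integral_distr[symmetric]) (auto simp: measurable_restrict_space1)
  also have "\<dots> = (LINT r|lborel. (2 * pi * r * indicator {a..b} r) *\<^sub>R g r)"
    unfolding distr_norm_annulus[OF assms(1,2)]
    using assms g_meas by (intro integral_density) (auto simp: indicator_def)
  also have "\<dots> = (LINT r:{a..b}|lborel. 2 * pi * (r * f r))"
    unfolding set_lebesgue_integral_def
    by (intro Bochner_Integration.integral_cong) (auto simp: indicator_def g_def)
  also have "\<dots> = integral {a..b} (\<lambda>r. 2 * pi * (r * f r))"
    by (intro set_borel_integral_eq_integral borel_integrable_atLeastAtMost')
      (auto intro!: continuous_intros cont)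
  finally show ?thesis by simp
qed

section \<open>Real functions of one variable\<close>

text \<open>Monotonicity replaces the implicit function theorem: if \<open>e s v < k\<close> for some \<open>v\<close> just below \<open>V s\<close>,
  the same inequality holds for all \<open>r\<close> near \<open>s\<close> and keeps \<open>V r\<close> above \<open>v\<close>; likewise from above.\<close>

lemma continuous_on_implicit:
  fixes e :: "'t::topological_space \<Rightarrow> real \<Rightarrow> real"
  assumes cont: "\<And>v. l < v \<Longrightarrow> v < u \<Longrightarrow> continuous_on S (\<lambda>r. e r v)"
    and mono: "\<And>r v w. r \<in> S \<Longrightarrow> l < v \<Longrightarrow> v < w \<Longrightarrow> w < u \<Longrightarrow> e r v < e r w"
    and V: "\<And>r. r \<in> S \<Longrightarrow> l < V r" "\<And>r. r \<in> S \<Longrightarrow> V r < u" "\<And>r. r \<in> S \<Longrightarrow> e r (V r) = k"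
  shows "continuous_on S V"
  unfolding continuous_on_def
proof (intro ballI order_tendstoI)
  fix s b assume s: "s \<in> S" and b: "b < V s"
  obtain v where v: "max b l < v" "v < V s"
    using dense[of "max b l" "V s"] b V(1)[OF s] by auto
  with V[OF s] mono[OF s, of v "V s"] have "e s v < k" "l < v" "v < u" by auto
  moreover have "((\<lambda>r. e r v) \<longlongrightarrow> e s v) (at s within S)"
    using cont \<open>l < v\<close> \<open>v < u\<close> s by (auto simp: continuous_on_def)
  ultimately have "\<forall>\<^sub>F r in at s within S. e r v < k"
    by (blast dest: order_tendstoD(2))
  moreover have "\<forall>\<^sub>F r in at s within S. r \<in> S"
    by (simp add: eventually_at_filter)
  ultimately show "\<forall>\<^sub>F r in at s within S. b < V r"
  proof eventually_elim
    case (elim r)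
    then have "v < V r"
      using V[of r] mono[of r "V r" v] \<open>v < u\<close> by (cases "V r" v rule: linorder_cases) auto
    then show ?case using v by simp
  qed
next
  fix s b assume s: "s \<in> S" and b: "V s < b"
  obtain v where v: "V s < v" "v < min b u"
    using dense[of "V s" "min b u"] b V(2)[OF s] by auto
  with V[OF s] mono[OF s, of "V s" v] have "k < e s v" "l < v" "v < u" by auto
  moreover have "((\<lambda>r. e r v) \<longlongrightarrow> e s v) (at s within S)"
    using cont \<open>l < v\<close> \<open>v < u\<close> s by (auto simp: continuous_on_def)
  ultimately have "\<forall>\<^sub>F r in at s within S. k < e r v"
    by (blast dest: order_tendstoD(1))
  moreover have "\<forall>\<^sub>F r in at s within S. r \<in> S"
    by (simp add: eventually_at_filter)
  ultimately show "\<forall>\<^sub>F r in at s within S. V r < b"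
  proof eventually_elim
    case (elim r)
    then have "V r < v"
      using V[of r] mono[of r v "V r"] \<open>l < v\<close> by (cases "V r" v rule: linorder_cases) auto
    then show ?case using v by simp
  qed
qed

lemma antiderivative_unique:
  fixes f g :: "real \<Rightarrow> real"
  assumes "\<And>r. r \<in> {a..b} \<Longrightarrow> (f has_real_derivative D r) (at r within {a..b})"
    and "\<And>r. r \<in> {a..b} \<Longrightarrow> (g has_real_derivative D r) (at r within {a..b})"
    and "c \<in> {a..b}" "f c = g c" "r \<in> {a..b}"
  shows "f r = g r"
proof -
  have "\<exists>k. \<forall>x\<in>{a..b}. f x - g x = k"
    using DERIV_diff[OF assms(1,2)] by (intro has_field_derivative_zero_constant) auto
  then show ?thesis
    using assms(3-5) by (metis eq_iff_diff_eq_0)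
qed

lemma has_real_derivative_eq_on:
  assumes "(f has_real_derivative d) (at x within S)" "x \<in> S" "\<And>y. y \<in> S \<Longrightarrow> g y = f y"
  shows "(g has_real_derivative d) (at x within S)"
  using assms(1) unfolding has_field_derivative_def
  by (rule has_derivative_transform[rotated 2]) (fact assms(2), rule assms(3))

lemma lipschitz_on_deriv_bound:
  fixes f :: "real \<Rightarrow> real"
  assumes "\<And>r. r \<in> {a..b} \<Longrightarrow> (f has_real_derivative D r) (at r within {a..b})"
    and "\<And>r. r \<in> {a..b} \<Longrightarrow> \<bar>D r\<bar> \<le> C" "0 \<le> C"
  shows "C-lipschitz_on {a..b} f"
proof (rule lipschitz_onI)
  fix x y assume "x \<in> {a..b}" "y \<in> {a..b}"
  then have "norm (f x - f y) \<le> C * norm (x - y)"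
    using assms by (intro field_differentiable_bound[of "{a..b}" f D]) auto
  then show "dist (f x) (f y) \<le> C * dist x y"
    by (simp add: dist_norm)
qed fact

section \<open>The supersonic and the subsonic speed\<close>

context radial_model
begin

text \<open>The constant \<open>k\<close> in \<open>p = k \<rho>\<^sup>\<gamma>\<close> of a flow that passes radius \<open>r\<close> at speed \<open>V\<close> with the given mass
  flux and Bernoulli constant.\<close>

definition entropy :: "real \<Rightarrow> real \<Rightarrow> real" where
  "entropy r V = (\<gamma> - 1) / (2 * \<gamma>) * (r * V / M0) powr (\<gamma> - 1) * (q_hat\<^sup>2 - V\<^sup>2)"

text \<open>The part of \<open>ln (entropy r V)\<close> that depends on \<open>V\<close>.  In logarithms the radius and the speed
  separate, so all monotonicity questions concern this one function, whose maximum is at the sonic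
  speed.\<close>

definition log_flux :: "real \<Rightarrow> real" where
  "log_flux V = (\<gamma> - 1) * ln V + ln (q_hat\<^sup>2 - V\<^sup>2)"

lemma M0_pos: "0 < M0"
  unfolding M0_def using rho0_pos v0_pos a_pos a_less_R by simp

lemma q_hat_pos: "0 < q_hat"
proof -
  have "0 < v0\<^sup>2 + 2 * \<gamma> / (\<gamma> - 1) * k0 * \<rho>0 powr (\<gamma> - 1)"
    using gamma_gt_1 k0_pos v0_pos by (intro add_pos_nonneg) auto
  then show ?thesis by (simp add: q_hat_def)
qed

lemma c_star_pos: "0 < c_star"
  unfolding c_star_def using gamma_gt_1 q_hat_pos by simp

lemma c_star_sq: "(\<gamma> + 1) * c_star\<^sup>2 = (\<gamma> - 1) * q_hat\<^sup>2"
  proof -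
  have "c_star\<^sup>2 = (\<gamma> - 1) / (\<gamma> + 1) * q_hat\<^sup>2"
    unfolding c_star_def using gamma_gt_1 by (intro real_sqrt_pow2) auto
  then show ?thesis using gamma_gt_1 by simp
qed

lemma c_star_less_q_hat: "c_star < q_hat"
proof -
  have "(\<gamma> + 1) * c_star\<^sup>2 < (\<gamma> + 1) * q_hat\<^sup>2"
    unfolding c_star_sq using q_hat_pos by simp
  then have "c_star\<^sup>2 < q_hat\<^sup>2" using gamma_gt_1 by simp
  then show ?thesis using q_hat_pos by (simp add: power2_less_imp_less)
qed

lemma ka_pos: "0 < ka"
  using k0_pos k0_less_ka by simp

lemma square_less_q_hat:
  assumes "0 < V" "V < q_hat"
  shows "V\<^sup>2 < q_hat\<^sup>2"
  using assms by (intro power_strict_mono) auto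

lemma entropy_pos:
  assumes "0 < r" "0 < V" "V < q_hat"
  shows "0 < entropy r V"
  unfolding entropy_def using assms gamma_gt_1 M0_pos square_less_q_hat[of V] by simp

lemma ln_entropy:
  assumes "0 < r" "0 < V" "V < q_hat"
  shows "ln (entropy r V) = ln ((\<gamma> - 1) / (2 * \<gamma>)) + (\<gamma> - 1) * (ln r - ln M0) + log_flux V"
proof -
  have pos: "0 < (\<gamma> - 1) / (2 * \<gamma>)" "0 < r * V / M0" "0 < q_hat\<^sup>2 - V\<^sup>2"
    using assms gamma_gt_1 M0_pos square_less_q_hat[of V] by auto
  have powr_pos: "0 < (r * V / M0) powr (\<gamma> - 1)"
    using pos(2) by (metis powr_gt_zero less_irrefl)
  have ln_mass: "ln (r * V / M0) = ln r + ln V - ln M0"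
    using assms M0_pos by (simp add: ln_div ln_mult)
  have "ln (entropy r V) = ln ((\<gamma> - 1) / (2 * \<gamma>)) + (\<gamma> - 1) * (ln r + ln V - ln M0) + ln (q_hat\<^sup>2 - V\<^sup>2)"
    unfolding entropy_def ln_mult_pos[OF mult_pos_pos[OF pos(1) powr_pos] pos(3)]
      ln_mult_pos[OF pos(1) powr_pos] ln_powr ln_mass ..
  then show ?thesis
    by (simp add: log_flux_def algebra_simps)
qed

lemma log_flux_deriv:
  assumes "0 < V" "V < q_hat"
  shows "(log_flux has_real_derivative (\<gamma> + 1) * (c_star\<^sup>2 - V\<^sup>2) / (V * (q_hat\<^sup>2 - V\<^sup>2))) (at V)"
proof -
  have pos: "0 < q_hat\<^sup>2 - V\<^sup>2"
    using square_less_q_hat[OF assms] by simp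
  have "(log_flux has_real_derivative (\<gamma> - 1) * (1 / V) + - (2 * V) / (q_hat\<^sup>2 - V\<^sup>2)) (at V)"
    unfolding log_flux_def using assms pos
    by (auto intro!: derivative_eq_intros)
  moreover have "(\<gamma> - 1) * (1 / V) + - (2 * V) / (q_hat\<^sup>2 - V\<^sup>2)
      = (\<gamma> + 1) * (c_star\<^sup>2 - V\<^sup>2) / (V * (q_hat\<^sup>2 - V\<^sup>2))"
  proof -
    have "(\<gamma> + 1) * (c_star\<^sup>2 - V\<^sup>2) = (\<gamma> - 1) * (q_hat\<^sup>2 - V\<^sup>2) - 2 * V * V"
      using c_star_sq by (simp add: algebra_simps power2_eq_square)
    then show ?thesis
      using assms pos by (simp add: field_simps)
  qed
  ultimately show ?thesis by simp
qed

lemma log_flux_strict_mono: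
  assumes "0 < V" "V < W" "W \<le> c_star"
  shows "log_flux V < log_flux W"
proof (rule DERIV_pos_imp_increasing_open[OF assms(2)])
  fix x assume x: "V < x" "x < W"
  then have x': "0 < x" "x < c_star" "x < q_hat"
    using assms c_star_less_q_hat by auto
  then have "x\<^sup>2 < c_star\<^sup>2" by (intro power_strict_mono) auto
  then have "0 < (\<gamma> + 1) * (c_star\<^sup>2 - x\<^sup>2) / (x * (q_hat\<^sup>2 - x\<^sup>2))"
    using x' square_less_q_hat[of x] gamma_gt_1 by simp
  then show "\<exists>y. (log_flux has_real_derivative y) (at x) \<and> 0 < y"
    using log_flux_deriv[of x] x' by blast
next
  show "continuous_on {V..W} log_flux"
    using assms c_star_less_q_hat
    by (intro continuous_at_imp_continuous_on ballI DERIV_isCont[OF log_flux_deriv]) auto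
qed

lemma log_flux_strict_antimono:
  assumes "c_star \<le> V" "V < W" "W < q_hat"
  shows "log_flux W < log_flux V"
proof (rule DERIV_neg_imp_decreasing_open[OF assms(2)])
  fix x assume x: "V < x" "x < W"
  then have x': "0 < x" "c_star < x" "x < q_hat"
    using assms c_star_pos by auto
  then have "c_star\<^sup>2 < x\<^sup>2" using c_star_pos by (intro power_strict_mono) auto
  then have "(\<gamma> + 1) * (c_star\<^sup>2 - x\<^sup>2) / (x * (q_hat\<^sup>2 - x\<^sup>2)) < 0"
    using x' square_less_q_hat[of x] gamma_gt_1 by (intro divide_neg_pos mult_pos_neg) auto
  then show "\<exists>y. (log_flux has_real_derivative y) (at x) \<and> y < 0"
    using log_flux_deriv[of x] x' by blast
next
  show "continuous_on {V..W} log_flux"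
    using assms c_star_pos
    by (intro continuous_at_imp_continuous_on ballI DERIV_isCont[OF log_flux_deriv]) auto
qed

lemma entropy_strict_mono:
  assumes "0 < r" "0 < V" "V < W" "W \<le> c_star"
  shows "entropy r V < entropy r W"
proof -
  have "ln (entropy r V) < ln (entropy r W)"
    using assms c_star_less_q_hat log_flux_strict_mono[of V W] by (simp add: ln_entropy)
  then show ?thesis
    using assms c_star_less_q_hat by (subst (asm) ln_less_cancel_iff) (auto intro: entropy_pos)
qed

lemma entropy_strict_antimono:
  assumes "0 < r" "c_star \<le> V" "V < W" "W < q_hat"
  shows "entropy r W < entropy r V"
proof -
  have "ln (entropy r W) < ln (entropy r V)"
    using assms c_star_pos log_flux_strict_antimono[of V W] by (simp add: ln_entropy)
  then show ?thesis
    using assms c_star_pos by (subst (asm) ln_less_cancel_iff) (auto intro: entropy_pos)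
qed

lemma entropy_continuous: "continuous_on {0..} (entropy r)" if "0 \<le> r"
  unfolding entropy_def using gamma_gt_1 M0_pos that
  by (intro continuous_intros continuous_on_powr') auto

text \<open>At a given speed the density falls with the radius, so the same enthalpy needs a larger constant.\<close>

lemma entropy_strict_mono_radius:
  assumes "0 < r" "r < s" "0 < V" "V < q_hat"
  shows "entropy r V < entropy s V"
proof -
  have "ln (entropy r V) < ln (entropy s V)"
    using assms gamma_gt_1 by (simp add: ln_entropy)
  then show ?thesis
    using assms by (subst (asm) ln_less_cancel_iff) (auto intro: entropy_pos)
qed

text \<open>The upper bound assumed for \<open>ka\<close> is the entropy constant of sonic flow at the inner circle, where
  it is smallest.  It keeps both branches away from the sonic speed on the whole interval.\<close>

lemma ka_less_entropy_sonic:
  assumes "a \<le> r"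
  shows "ka < entropy r c_star"
proof -
  have "entropy a c_star = 1 / \<gamma> * (a / M0) powr (\<gamma> - 1) * c_star powr (\<gamma> + 1)"
  proof -
    have "q_hat\<^sup>2 - c_star\<^sup>2 = 2 / (\<gamma> - 1) * c_star\<^sup>2"
      using c_star_sq gamma_gt_1 by (simp add: field_simps)
    moreover have "(a * c_star / M0) powr (\<gamma> - 1) = (a / M0) powr (\<gamma> - 1) * c_star powr (\<gamma> - 1)"
      using a_pos M0_pos c_star_pos by (simp flip: powr_mult)
    moreover have "c_star powr (\<gamma> + 1) = c_star powr (\<gamma> - 1) * c_star\<^sup>2"
      using c_star_pos by (simp add: add.commute flip: powr_numeral powr_add)
    ultimately show ?thesis
      unfolding entropy_def using gamma_gt_1 by simp
  qed
  then have "ka < entropy a c_star" using ka_less by simp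
  also have "\<dots> \<le> entropy r c_star"
    using assms entropy_strict_mono_radius[of a r c_star] a_pos c_star_pos c_star_less_q_hat
    by (cases "a = r") auto
  finally show ?thesis .
qed

lemma supersonic_ex1:
  assumes "a \<le> r"
  shows "\<exists>!V. c_star < V \<and> V < q_hat \<and> k0 = entropy r V"
proof (rule ex_ex1I)
  have r: "0 < r" using assms a_pos by simp
  have "entropy r q_hat \<le> k0" "k0 \<le> entropy r c_star"
    using ka_less_entropy_sonic[OF assms] k0_less_ka k0_pos by (auto simp: entropy_def)
  moreover have "continuous_on {c_star..q_hat} (entropy r)"
    using entropy_continuous[of r] r c_star_pos by (auto intro: continuous_on_subset)
  ultimately obtain V where V: "c_star \<le> V" "V \<le> q_hat" "entropy r V = k0"
    using IVT2'[of "entropy r" q_hat k0 c_star] c_star_less_q_hat by auto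
  moreover have "V \<noteq> c_star" "V \<noteq> q_hat"
    using V(3) ka_less_entropy_sonic[OF assms] k0_less_ka k0_pos by (auto simp: entropy_def)
  ultimately show "\<exists>V. c_star < V \<and> V < q_hat \<and> k0 = entropy r V"
    by (intro exI[of _ V]) auto
  show "V = W" if "c_star < V \<and> V < q_hat \<and> k0 = entropy r V"
    "c_star < W \<and> W < q_hat \<and> k0 = entropy r W" for V W
    using that entropy_strict_antimono[of r V W] entropy_strict_antimono[of r W V] r
    by (cases V W rule: linorder_cases) auto
qed

lemma subsonic_ex1:
  assumes "a \<le> r"
  shows "\<exists>!V. 0 < V \<and> V < c_star \<and> ka = entropy r V"
proof (rule ex_ex1I)
  have r: "0 < r" using assms a_pos by simp
  have "entropy r 0 \<le> ka" "ka \<le> entropy r c_star"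
    using ka_less_entropy_sonic[OF assms] ka_pos by (auto simp: entropy_def)
  moreover have "continuous_on {0..c_star} (entropy r)"
    using entropy_continuous[of r] r by (auto intro: continuous_on_subset)
  ultimately obtain V where V: "0 \<le> V" "V \<le> c_star" "entropy r V = ka"
    using IVT'[of "entropy r" 0 ka c_star] c_star_pos by auto
  moreover have "V \<noteq> c_star" "V \<noteq> 0"
    using V(3) ka_less_entropy_sonic[OF assms] ka_pos by (auto simp: entropy_def)
  ultimately show "\<exists>V. 0 < V \<and> V < c_star \<and> ka = entropy r V"
    by (intro exI[of _ V]) auto
  show "V = W" if "0 < V \<and> V < c_star \<and> ka = entropy r V"
    "0 < W \<and> W < c_star \<and> ka = entropy r W" for V W
    using that entropy_strict_mono[of r V W] entropy_strict_mono[of r W V] r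
    by (cases V W rule: linorder_cases) auto
qed

definition V_sub :: "real \<Rightarrow> real" where
  "V_sub r = (THE V. 0 < V \<and> V < c_star \<and> ka = entropy r V)"

lemma V_sup:
  assumes "a \<le> r"
  shows "c_star < V_sup k0 r" "V_sup k0 r < q_hat" "entropy r (V_sup k0 r) = k0" "0 < V_sup k0 r"
proof -
  have "V_sup k0 r = (THE V. c_star < V \<and> V < q_hat \<and> k0 = entropy r V)"
    unfolding V_sup_def entropy_def ..
  then show "c_star < V_sup k0 r" "V_sup k0 r < q_hat" "entropy r (V_sup k0 r) = k0"
    using theI'[OF supersonic_ex1[OF assms]] by auto
  then show "0 < V_sup k0 r" using c_star_pos by simp
qed

lemma V_sub:
  assumes "a \<le> r"
  shows "0 < V_sub r" "V_sub r < c_star" "entropy r (V_sub r) = ka" "V_sub r < q_hat"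
  using theI'[OF subsonic_ex1[OF assms]] c_star_less_q_hat by (auto simp: V_sub_def)

lemma V_sub_unique:
  assumes "a \<le> r" "0 < V" "V < c_star" "entropy r V = ka"
  shows "V_sub r = V"
  using subsonic_ex1[OF assms(1)] V_sub[OF assms(1)] assms by metis

lemma V_sub_inner: "V_sub a = va"
  using subsonic_at_a va_pos by (intro V_sub_unique) (auto simp: entropy_def ka_def)

text \<open>A larger radius raises the entropy constant, and on the supersonic branch only a larger speed
  brings it back to \<open>k0\<close>.\<close>

lemma V_sup_strict_mono:
  assumes "a \<le> r" "r < s"
  shows "V_sup k0 r < V_sup k0 s"
proof (rule ccontr)
  assume "\<not> ?thesis"
  then have "entropy s (V_sup k0 r) \<le> entropy s (V_sup k0 s)"
    using V_sup[of r] V_sup[of s] assms a_pos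
      entropy_strict_antimono[of s "V_sup k0 s" "V_sup k0 r"]
    by (cases "V_sup k0 r = V_sup k0 s") auto
  moreover have "entropy r (V_sup k0 r) < entropy s (V_sup k0 r)"
    using V_sup[of r] assms a_pos by (intro entropy_strict_mono_radius) auto
  ultimately show False
    using V_sup(3)[of r] V_sup(3)[of s] assms by simp
qed

lemma V_sup_continuous: "continuous_on {a..} (V_sup k0)"
proof (rule continuous_on_implicit[where e = "\<lambda>r V. - entropy r V" and l = c_star and u = q_hat])
  show "continuous_on {a..} (\<lambda>r. - entropy r V)" if "c_star < V" for V
    unfolding entropy_def using a_pos gamma_gt_1 M0_pos c_star_pos that
    by (intro continuous_intros continuous_on_powr') auto
qed (use V_sup entropy_strict_antimono a_pos in auto)

lemma V_sub_continuous: "continuous_on {a..} V_sub"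
proof (rule continuous_on_implicit[where e = entropy and l = 0 and u = c_star])
  show "continuous_on {a..} (\<lambda>r. entropy r V)" if "0 < V" for V
    unfolding entropy_def using a_pos gamma_gt_1 M0_pos that
    by (intro continuous_intros continuous_on_powr') auto
qed (use V_sub entropy_strict_mono a_pos in auto)

section \<open>Prandtl relation and entropy production of a normal shock\<close>

text \<open>By the Prandtl relation a normal shock takes the speed \<open>s\<close> to the conjugate speed \<open>c\<^sub>*\<^sup>2 / s\<close>.  At
  equal radius and mass flux this difference is the logarithm of the ratio of the entropy constants
  behind and ahead of it.\<close>

definition shock_entropy_jump :: "real \<Rightarrow> real" where
  "shock_entropy_jump s = log_flux (c_star\<^sup>2 / s) - log_flux s"

lemma conjugate_speed:
  assumes "c_star < s"
  shows "0 < c_star\<^sup>2 / s" "c_star\<^sup>2 / s < c_star"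
  using assms c_star_pos by (auto simp: power2_eq_square field_simps)

text \<open>A stronger shock produces more entropy.  By \<open>log_flux_deriv\<close> the derivative factors through
  \<open>s\<^sup>2 - c\<^sub>*\<^sup>2\<close>, and what remains is the comparison of \<open>1 / (q\<^sup>2 - s\<^sup>2)\<close> with \<open>c\<^sub>*\<^sup>2 / (q\<^sup>2 s\<^sup>2 - c\<^sub>*\<^sup>4)\<close>;
  the cross difference is again a positive multiple of \<open>s\<^sup>2 - c\<^sub>*\<^sup>2\<close>.\<close>

lemma shock_entropy_jump_strict_mono:
  assumes "c_star < s" "s < t" "t < q_hat"
  shows "shock_entropy_jump s < shock_entropy_jump t"
proof (rule DERIV_pos_imp_increasing[OF assms(2)])
  fix x assume "s \<le> x" "x \<le> t"
  then have x: "0 < x" "c_star < x" "x < q_hat"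
    using assms c_star_pos by auto
  define A where "A = q_hat\<^sup>2 - x\<^sup>2"
  define B where "B = q_hat\<^sup>2 * x\<^sup>2 - c_star\<^sup>2 * c_star\<^sup>2"
  \<comment> \<open>\<open>A\<close>, \<open>B\<close> and \<open>d\<close> are positive, and the derivative has the sign of \<open>d (B - c\<^sub>*\<^sup>2 A)\<close>.\<close>
  define d where "d = x\<^sup>2 - c_star\<^sup>2"
  have A: "0 < A" using square_less_q_hat x by (simp add: A_def)
  have d: "0 < d" using power_strict_mono[of c_star x 2] x c_star_pos by (simp add: d_def)
  have gap: "B - c_star\<^sup>2 * A = (q_hat\<^sup>2 + c_star\<^sup>2) * d"
    by (simp add: A_def B_def d_def algebra_simps)
  have gap_pos: "0 < (q_hat\<^sup>2 + c_star\<^sup>2) * d"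
    using d q_hat_pos by (intro mult_pos_pos add_pos_nonneg) auto
  then have B: "0 < B"
    using gap A by (smt (verit) mult_nonneg_nonneg zero_le_power2)
  let ?y = "c_star\<^sup>2 / x"
  have y: "0 < ?y" "?y < q_hat"
    using conjugate_speed[OF x(2)] c_star_less_q_hat by auto
  have "((\<lambda>x. c_star\<^sup>2 / x) has_real_derivative - (c_star\<^sup>2 / x\<^sup>2)) (at x)"
    using x by (auto intro!: derivative_eq_intros simp: power2_eq_square)
  from DERIV_chain2[OF log_flux_deriv[OF y] this] log_flux_deriv[OF x(1,3)]
  have "(shock_entropy_jump has_real_derivative
      (\<gamma> + 1) * (c_star\<^sup>2 - ?y\<^sup>2) / (?y * (q_hat\<^sup>2 - ?y\<^sup>2)) * - (c_star\<^sup>2 / x\<^sup>2)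
      - (\<gamma> + 1) * (c_star\<^sup>2 - x\<^sup>2) / (x * (q_hat\<^sup>2 - x\<^sup>2))) (at x)"
    unfolding shock_entropy_jump_def by (rule DERIV_diff)
  moreover have "(\<gamma> + 1) * (c_star\<^sup>2 - ?y\<^sup>2) / (?y * (q_hat\<^sup>2 - ?y\<^sup>2)) * - (c_star\<^sup>2 / x\<^sup>2)
      - (\<gamma> + 1) * (c_star\<^sup>2 - x\<^sup>2) / (x * (q_hat\<^sup>2 - x\<^sup>2))
    = (\<gamma> + 1) * d / x * (1 / A - c_star\<^sup>2 / B)"
  proof -
    have 1: "c_star\<^sup>2 - ?y\<^sup>2 = c_star\<^sup>2 * d / x\<^sup>2"
      using x by (simp add: d_def field_simps power2_eq_square)
    have 2: "q_hat\<^sup>2 - ?y\<^sup>2 = B / x\<^sup>2"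
      using x by (simp add: B_def field_simps power2_eq_square)
    have 3: "c_star\<^sup>2 - x\<^sup>2 = - d" "q_hat\<^sup>2 - x\<^sup>2 = A"
      by (auto simp: d_def A_def)
    show ?thesis
      unfolding 1 2 3 using x c_star_pos A B
      by (simp add: field_simps power2_eq_square)
  qed
  moreover have "0 < (\<gamma> + 1) * d / x * (1 / A - c_star\<^sup>2 / B)"
  proof -
    have "1 / A - c_star\<^sup>2 / B = (B - c_star\<^sup>2 * A) / (A * B)"
      using A B by (simp add: field_simps)
    then have "0 < 1 / A - c_star\<^sup>2 / B"
      using A B gap gap_pos by simp
    then show ?thesis using d x gamma_gt_1 by simp
  qed
  ultimately show "\<exists>y. (shock_entropy_jump has_real_derivative y) (at x) \<and> 0 < y"
    by auto
qed

text \<open>The mass flux and the radius enter the logarithms of both entropy constants alike and cancel.\<close>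

lemma log_flux_jump:
  assumes "a \<le> r"
  shows "log_flux (V_sub r) - log_flux (V_sup k0 r) = ln ka - ln k0"
  using ln_entropy[of r "V_sub r"] ln_entropy[of r "V_sup k0 r"] V_sub[OF assms] V_sup[OF assms]
    assms a_pos by simp

lemma log_flux_le_iff:
  assumes "0 < V" "V \<le> c_star" "0 < W" "W \<le> c_star"
  shows "log_flux V \<le> log_flux W \<longleftrightarrow> V \<le> W"
  using assms log_flux_strict_mono[of V W] log_flux_strict_mono[of W V]
  by (cases V W rule: linorder_cases) auto

text \<open>The product of the two speeds is at most \<open>c\<^sub>*\<^sup>2\<close> when the subsonic speed is at most the conjugate
  of the supersonic one; both lie on the branch where \<open>log_flux\<close> increases, so the comparison can be
  made between the prescribed entropy jump and that of a normal shock.\<close>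

lemma prandtl_le_iff:
  assumes "a \<le> r"
  shows "V_sub r * V_sup k0 r \<le> c_star\<^sup>2 \<longleftrightarrow> ln ka - ln k0 \<le> shock_entropy_jump (V_sup k0 r)"
    and "c_star\<^sup>2 \<le> V_sub r * V_sup k0 r \<longleftrightarrow> shock_entropy_jump (V_sup k0 r) \<le> ln ka - ln k0"
proof -
  note sup = V_sup[OF assms] and sub = V_sub[OF assms]
  note conj = conjugate_speed[OF sup(1)]
  have "V_sub r * V_sup k0 r \<le> c_star\<^sup>2 \<longleftrightarrow> V_sub r \<le> c_star\<^sup>2 / V_sup k0 r"
    using sup by (simp add: field_simps)
  also have "\<dots> \<longleftrightarrow> log_flux (V_sub r) \<le> log_flux (c_star\<^sup>2 / V_sup k0 r)"
    using sub conj by (intro log_flux_le_iff[symmetric]) auto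
  finally show "V_sub r * V_sup k0 r \<le> c_star\<^sup>2 \<longleftrightarrow> ln ka - ln k0 \<le> shock_entropy_jump (V_sup k0 r)"
    using log_flux_jump[OF assms] by (auto simp: shock_entropy_jump_def)
  have "c_star\<^sup>2 \<le> V_sub r * V_sup k0 r \<longleftrightarrow> c_star\<^sup>2 / V_sup k0 r \<le> V_sub r"
    using sup by (simp add: field_simps)
  also have "\<dots> \<longleftrightarrow> log_flux (c_star\<^sup>2 / V_sup k0 r) \<le> log_flux (V_sub r)"
    using sub conj by (intro log_flux_le_iff[symmetric]) auto
  finally show "c_star\<^sup>2 \<le> V_sub r * V_sup k0 r \<longleftrightarrow> shock_entropy_jump (V_sup k0 r) \<le> ln ka - ln k0"
    using log_flux_jump[OF assms] by (auto simp: shock_entropy_jump_def)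
qed

text \<open>The prescribed jump \<open>ln ka - ln k0\<close> is the same at every radius, while the jump of the normal
  shock grows with the radius.\<close>

lemma prandtl_single_crossing:
  assumes "a \<le> r" "r < s" "V_sub r * V_sup k0 r \<le> c_star\<^sup>2"
  shows "V_sub s * V_sup k0 s < c_star\<^sup>2"
proof -
  have "shock_entropy_jump (V_sup k0 r) < shock_entropy_jump (V_sup k0 s)"
    using V_sup[of r] V_sup[of s] V_sup_strict_mono[of r s] assms
    by (intro shock_entropy_jump_strict_mono) auto
  then show ?thesis
    using prandtl_le_iff(1)[of r] prandtl_le_iff(2)[of s] assms by linarith
qed

section \<open>The unique profile with a given shock position\<close>

lemma phi_sup:
  shows phi_sup_extensional: "phi_sup \<in> extensional {a..R}"
    and phi_sup_R: "phi_sup R = 0"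
    and phi_sup_deriv: "r \<in> {a..R} \<Longrightarrow> (phi_sup has_real_derivative V_sup k0 r) (at r within {a..R})"
proof -
  let ?P = "\<lambda>\<phi>. \<phi> \<in> extensional {a..R} \<and> \<phi> R = 0 \<and>
     (\<forall>r\<in>{a..R}. (\<phi> has_real_derivative V_sup k0 r) (at r within {a..R}))"
  let ?p = "\<lambda>r. integral {a..r} (V_sup k0) - integral {a..R} (V_sup k0)"
  have cont: "continuous_on {a..R} (V_sup k0)"
    using V_sup_continuous by (rule continuous_on_subset) auto
  have "\<exists>!\<phi>. ?P \<phi>"
  proof (rule ex_ex1I)
    have "(restrict ?p {a..R} has_real_derivative V_sup k0 r) (at r within {a..R})"
      if "r \<in> {a..R}" for r
    proof (rule has_real_derivative_eq_on)
      show "(?p has_real_derivative V_sup k0 r) (at r within {a..R})"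
        using DERIV_diff[OF integral_has_real_derivative[OF cont that] DERIV_const] by simp
    qed (use that in auto)
    then show "\<exists>\<phi>. ?P \<phi>"
      using a_less_R by (intro exI[of _ "restrict ?p {a..R}"]) auto
    show "\<phi> = \<psi>" if "?P \<phi>" "?P \<psi>" for \<phi> \<psi>
    proof (rule extensionalityI)
      show "\<phi> r = \<psi> r" if "r \<in> {a..R}" for r
        by (rule antiderivative_unique[where f = \<phi> and g = \<psi> and D = "V_sup k0" and c = R])
          (use \<open>?P \<phi>\<close> \<open>?P \<psi>\<close> that a_less_R in auto)
    qed (use that in auto)
  qed
  from theI'[OF this] have "?P phi_sup" unfolding phi_sup_def .
  then show "phi_sup \<in> extensional {a..R}" "phi_sup R = 0"
    "r \<in> {a..R} \<Longrightarrow> (phi_sup has_real_derivative V_sup k0 r) (at r within {a..R})"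
    by auto
qed

text \<open>Turns the equation of conservation of mass that defines the flow behind the shock into the
  equation that defines \<open>V_sub\<close>.\<close>

lemma rho_sub_iff_entropy:
  assumes "0 < r" "0 < V" "V < q_hat"
  shows "rho_sub V * V * r = M0 \<longleftrightarrow> entropy r V = ka"
proof -
  define X where "X = 1 / ka * ((\<gamma> - 1) / (2 * \<gamma>)) * (q_hat\<^sup>2 - V\<^sup>2)"
  define t where "t = r * V / M0"
  have X: "0 < X"
    using ka_pos gamma_gt_1 square_less_q_hat[of V] assms by (simp add: X_def)
  have t: "0 < t"
    using assms M0_pos by (simp add: t_def)
  have rho: "rho_sub V = X powr (1 / (\<gamma> - 1))"
    by (simp add: rho_sub_def X_def)
  have rho_pos: "0 < rho_sub V * t" using X t rho by simp
  have "rho_sub V * V * r = M0 \<longleftrightarrow> rho_sub V * t = 1"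
    using M0_pos by (auto simp: t_def field_simps)
  also have "\<dots> \<longleftrightarrow> (rho_sub V * t) powr (\<gamma> - 1) = 1"
    using rho_pos gamma_gt_1 by (auto simp: powr_def)
  also have "(rho_sub V * t) powr (\<gamma> - 1) = X * t powr (\<gamma> - 1)"
    using X t gamma_gt_1 by (simp add: rho powr_mult powr_powr)
  also have "X * t powr (\<gamma> - 1) = entropy r V / ka"
    by (simp add: X_def t_def entropy_def ac_simps)
  finally show ?thesis using ka_pos by auto
qed

definition sub_potential :: "real \<Rightarrow> real" where
  "sub_potential r = integral {a..r} V_sub"

lemma sub_potential_deriv:
  assumes "r \<in> {a..b}"
  shows "(sub_potential has_real_derivative V_sub r) (at r within {a..b})"
  unfolding sub_potential_def[abs_def] using assms
  by (intro integral_has_real_derivative continuous_on_subset[OF V_sub_continuous]) auto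

definition shock_profile :: "real \<Rightarrow> real \<Rightarrow> real" where
  "shock_profile \<eta> = (\<lambda>r\<in>{a..R}.
     if r \<le> \<eta> then phi_sup \<eta> + (sub_potential r - sub_potential \<eta>) else phi_sup r)"

lemma shock_profile_simps:
  assumes "\<eta> \<in> {a..R}"
  shows "r \<in> {a..\<eta>} \<Longrightarrow> shock_profile \<eta> r = phi_sup \<eta> + (sub_potential r - sub_potential \<eta>)"
    and "r \<in> {\<eta>..R} \<Longrightarrow> shock_profile \<eta> r = phi_sup r"
  using assms by (auto simp: shock_profile_def)

lemma shock_profile_deriv_sub:
  assumes "\<eta> \<in> {a..R}" "r \<in> {a..\<eta>}"
  shows "(shock_profile \<eta> has_real_derivative V_sub r) (at r within {a..\<eta>})"
proof -
  have "((\<lambda>r. phi_sup \<eta> + (sub_potential r - sub_potential \<eta>)) has_real_derivative V_sub r)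
      (at r within {a..\<eta>})"
    using assms by (auto intro!: derivative_eq_intros sub_potential_deriv)
  then show ?thesis
    using assms(2) shock_profile_simps(1)[OF assms(1)] by (rule has_real_derivative_eq_on)
qed

lemma shock_profile_deriv_sup:
  assumes "\<eta> \<in> {a..R}" "r \<in> {\<eta>..R}"
  shows "(shock_profile \<eta> has_real_derivative V_sup k0 r) (at r within {\<eta>..R})"
proof -
  have "(phi_sup has_real_derivative V_sup k0 r) (at r within {\<eta>..R})"
    using assms by (intro DERIV_subset[OF phi_sup_deriv]) auto
  then show ?thesis
    using assms(2) shock_profile_simps(2)[OF assms(1)] by (rule has_real_derivative_eq_on)
qed

lemma shock_profile_deriv_interior:
  assumes "\<eta> \<in> {a..R}"
  shows "a < r \<Longrightarrow> r < \<eta> \<Longrightarrow> (shock_profile \<eta> has_real_derivative V_sub r) (at r)"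
    and "\<eta> < r \<Longrightarrow> r < R \<Longrightarrow> (shock_profile \<eta> has_real_derivative V_sup k0 r) (at r)"
proof -
  show "(shock_profile \<eta> has_real_derivative V_sub r) (at r)" if "a < r" "r < \<eta>"
    using shock_profile_deriv_sub[OF assms, of r] that by (simp add: at_within_Icc_at)
  show "(shock_profile \<eta> has_real_derivative V_sup k0 r) (at r)" if "\<eta> < r" "r < R"
    using shock_profile_deriv_sup[OF assms, of r] that by (simp add: at_within_Icc_at)
qed

lemma shock_profile_has_shock:
  assumes "\<eta> \<in> {a..R}"
  shows "has_shock_at \<eta> (shock_profile \<eta>)"
  unfolding has_shock_at_def
proof (intro conjI exI[of _ V_sub] ballI)
  fix r assume r: "r \<in> {a..\<eta>}"
  show "(shock_profile \<eta> has_real_derivative V_sub r) (at r within {a..\<eta>})"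
    by (rule shock_profile_deriv_sub[OF assms r])
  show "0 < V_sub r" "V_sub r < c_star" using r V_sub[of r] by auto
  show "rho_sub (V_sub r) * V_sub r * r = M0"
    using r a_pos V_sub[of r] by (subst rho_sub_iff_entropy) auto
qed (use shock_profile_simps(2)[OF assms] assms in \<open>simp_all add: V_sub_inner\<close>)

text \<open>Conservation of mass fixes the speed behind the shock pointwise, and matching the supersonic
  potential at the shock fixes the constant of integration.\<close>

lemma has_shock_at_eq_profile:
  assumes \<eta>: "\<eta> \<in> {a..R}" and shock: "has_shock_at \<eta> \<phi>" and ext: "\<phi> \<in> extensional {a..R}"
  shows "\<phi> = shock_profile \<eta>"
proof (rule extensionalityI[OF ext])
  show "shock_profile \<eta> \<in> extensional {a..R}"
    by (simp add: shock_profile_def)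
  obtain V where V: "\<And>r. r \<in> {a..\<eta>} \<Longrightarrow> (\<phi> has_real_derivative V r) (at r within {a..\<eta>})"
    "\<And>r. r \<in> {a..\<eta>} \<Longrightarrow> 0 < V r" "\<And>r. r \<in> {a..\<eta>} \<Longrightarrow> V r < c_star"
    "\<And>r. r \<in> {a..\<eta>} \<Longrightarrow> rho_sub (V r) * V r * r = M0"
    using shock unfolding has_shock_at_def by blast
  have "V_sub r = V r" if "r \<in> {a..\<eta>}" for r
    using V[OF that] that a_pos c_star_less_q_hat rho_sub_iff_entropy[of r "V r"]
    by (intro V_sub_unique) auto
  then have deriv: "(\<phi> has_real_derivative V_sub r) (at r within {a..\<eta>})" if "r \<in> {a..\<eta>}" for r
    using V(1)[OF that] that by simp
  show "\<phi> r = shock_profile \<eta> r" if "r \<in> {a..R}" for r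
  proof (cases "r \<le> \<eta>")
    case True
    show ?thesis
    proof (rule antiderivative_unique[OF deriv shock_profile_deriv_sub[OF \<eta>]])
      show "\<phi> \<eta> = shock_profile \<eta> \<eta>"
        using shock \<eta> shock_profile_simps(2)[OF \<eta>, of \<eta>] by (simp add: has_shock_at_def)
    qed (use that True \<eta> in auto)
  next
    case False
    then show ?thesis
      using shock that shock_profile_simps(2)[OF \<eta>, of r] by (simp add: has_shock_at_def)
  qed
qed

lemma shock_profile_W1_infinity:
  assumes \<eta>: "\<eta> \<in> {a..R}"
  shows "W1_infinity annulus (radial (shock_profile \<eta>))"
proof -
  define D where "D r = indicat_real {a..\<eta>} r *\<^sub>R V_sub r + indicat_real {\<eta><..R} r *\<^sub>R V_sup k0 r" for r
  have sub: "q_hat-lipschitz_on {a..\<eta>} (shock_profile \<eta>)"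
  proof (rule lipschitz_on_deriv_bound[OF shock_profile_deriv_sub[OF \<eta>]])
    show "\<bar>V_sub r\<bar> \<le> q_hat" if "r \<in> {a..\<eta>}" for r
      using that V_sub[of r] by auto
  qed (use q_hat_pos in auto)
  have sup: "q_hat-lipschitz_on {\<eta>..R} (shock_profile \<eta>)"
  proof (rule lipschitz_on_deriv_bound[OF shock_profile_deriv_sup[OF \<eta>]])
    show "\<bar>V_sup k0 r\<bar> \<le> q_hat" if "r \<in> {\<eta>..R}" for r
      using that \<eta> V_sup[of r] by auto
  qed (use q_hat_pos in auto)
  have "q_hat-lipschitz_on {a..R} (shock_profile \<eta>)"
    using lipschitz_on_concat[OF sub sup] by simp
  then have lip: "q_hat-lipschitz_on {a<..<R} (shock_profile \<eta>)"
    by (rule lipschitz_on_subset) auto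
  have "W1_infinity {x. a < norm x \<and> norm x < R} (radial (shock_profile \<eta>))"
  proof (rule radial_W1_infinity[OF _ lip, where S = "{\<eta>}" and D = D])
    show "(shock_profile \<eta> has_real_derivative D r) (at r)" if "r \<in> {a<..<R} - {\<eta>}" for r
      using that shock_profile_deriv_interior[OF \<eta>, of r]
      by (cases "r < \<eta>") (auto simp: D_def indicator_def)
    show "D \<in> borel_measurable borel"
      unfolding D_def using \<eta>
      by (intro borel_measurable_add borel_measurable_continuous_on_indicator
          continuous_on_subset[OF V_sub_continuous] continuous_on_subset[OF V_sup_continuous]) auto
    show "\<bar>D r\<bar> \<le> q_hat" for r
      using V_sub[of r] V_sup[of r] \<eta> q_hat_pos by (auto simp: D_def indicator_def)
  qed (use a_pos in auto)
  then show ?thesis by (simp add: annulus_def)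
qed

lemma K1_at_eq:
  assumes "\<eta> \<in> {a..R}"
  shows "K1_at \<eta> = {shock_profile \<eta>}"
proof
  show "K1_at \<eta> \<subseteq> {shock_profile \<eta>}"
    using has_shock_at_eq_profile[OF assms] by (auto simp: K1_at_def K1_def)
  have "shock_profile \<eta> \<in> extensional {a..R}" by (simp add: shock_profile_def)
  then show "{shock_profile \<eta>} \<subseteq> K1_at \<eta>"
    using shock_profile_W1_infinity[OF assms] shock_profile_has_shock[OF assms] assms
    by (auto simp: K1_at_def K1_def)
qed

lemma J_eq_I:
  assumes "\<eta> \<in> {a..R}"
  shows "J \<eta> = I (radial (shock_profile \<eta>))"
  unfolding J_def K1_at_eq[OF assms] by simp

lemma sup_min_eq_SUP_J: "sup_min = (SUP \<eta>\<in>{a<..<R}. ereal (J \<eta>))"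
  unfolding sup_min_def
  by (intro SUP_cong refl) (auto simp: K1_at_eq J_eq_I)

text \<open>The two potentials agree at the shock, and going inwards the subsonic one decreases more slowly.\<close>

lemma shock_profile_above_phi_sup:
  assumes \<eta>: "\<eta> \<in> {a..R}" and r: "a < r" "r < \<eta>"
  shows "phi_sup r < shock_profile \<eta> r"
proof -
  let ?g = "\<lambda>r. shock_profile \<eta> r - phi_sup r"
  \<comment> \<open>\<open>?g\<close> decreases to its value zero at the shock.\<close>
  have deriv: "(?g has_real_derivative V_sub s - V_sup k0 s) (at s within {a..\<eta>})"
    if "s \<in> {a..\<eta>}" for s
    using that \<eta> by (intro DERIV_diff shock_profile_deriv_sub DERIV_subset[OF phi_sup_deriv]) auto
  have "?g \<eta> < ?g r"
  proof (rule DERIV_neg_imp_decreasing_open[OF r(2)])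
    fix s assume s: "r < s" "s < \<eta>"
    then have "(?g has_real_derivative V_sub s - V_sup k0 s) (at s)"
      using deriv[of s] r by (simp add: at_within_Icc_at)
    moreover have "V_sub s - V_sup k0 s < 0"
      using V_sub[of s] V_sup[of s] s r by simp
    ultimately show "\<exists>y. (?g has_real_derivative y) (at s) \<and> y < 0" by blast
  next
    have "continuous_on {a..\<eta>} ?g"
      using deriv by (rule DERIV_continuous_on)
    then show "continuous_on {r..\<eta>} ?g"
      by (rule continuous_on_subset) (use r in auto)
  qed
  then show ?thesis
    using shock_profile_simps(2)[OF \<eta>, of \<eta>] \<eta> by simp
qed

lemma Omega_shock_profile:
  assumes "\<eta> \<in> {a..R}"
  shows "Omega (radial (shock_profile \<eta>)) = {x. a < norm x \<and> norm x < \<eta>}"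
proof -
  have "phi_sup (norm x) < shock_profile \<eta> (norm x) \<longleftrightarrow> norm x < \<eta>"
    if "a < norm x" "norm x < R" for x :: plane
    using that shock_profile_above_phi_sup[OF assms, of "norm x"]
      shock_profile_simps(2)[OF assms, of "norm x"] by (cases "norm x < \<eta>") auto
  then show ?thesis
    using assms by (auto simp: Omega_def annulus_def radial_def)
qed

section \<open>The functional along the family of shock positions\<close>

text \<open>The quantity \<open>r p\<close> for a flow of speed \<open>V\<close>.  The radius and the entropy constant drop out once the
  mass flux and the Bernoulli constant are fixed.\<close>

definition thrust :: "real \<Rightarrow> real" where
  "thrust V = M0 * ((\<gamma> - 1) / (2 * \<gamma>)) * (q_hat\<^sup>2 - V\<^sup>2) / V"

text \<open>The constant in front of the pressure ahead of the shock and of the boundary term in the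
  functional; the next lemmas show that behind the shock it multiplies the pressure too.\<close>

definition weight :: real where
  "weight = \<gamma> powr (\<gamma> / (\<gamma> - 1)) * ka powr (1 / (\<gamma> - 1))"

lemma weight_pos: "0 < weight"
  using gamma_gt_1 ka_pos by (simp add: weight_def)

text \<open>Bernoulli's law, with the enthalpy written as \<open>k \<rho>\<^sup>\<gamma>\<^sup>-\<^sup>1\<close> up to a constant factor.\<close>

lemma entropy_density:
  assumes "0 < r" "0 < V"
  shows "entropy r V * (M0 / (r * V)) powr (\<gamma> - 1) = (\<gamma> - 1) / (2 * \<gamma>) * (q_hat\<^sup>2 - V\<^sup>2)"
proof -
  have "entropy r V * (M0 / (r * V)) powr (\<gamma> - 1) = (\<gamma> - 1) / (2 * \<gamma>) * (q_hat\<^sup>2 - V\<^sup>2)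
      * ((r * V / M0) powr (\<gamma> - 1) * (M0 / (r * V)) powr (\<gamma> - 1))"
    by (simp add: entropy_def ac_simps)
  also have "(r * V / M0) powr (\<gamma> - 1) * (M0 / (r * V)) powr (\<gamma> - 1) = 1"
    using assms M0_pos by (simp flip: powr_mult)
  finally show ?thesis by simp
qed

lemma pressure_eq_thrust:
  assumes "0 < r" "0 < V"
  shows "r * (entropy r V * (M0 / (r * V)) powr \<gamma>) = thrust V"
proof -
  have "(M0 / (r * V)) powr \<gamma> = (M0 / (r * V)) powr (\<gamma> - 1 + 1)"
    by simp
  also have "\<dots> = (M0 / (r * V)) powr (\<gamma> - 1) * (M0 / (r * V))"
    using assms M0_pos by (simp only: powr_add) simp
  finally have "r * (entropy r V * (M0 / (r * V)) powr \<gamma>)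
      = r * (entropy r V * (M0 / (r * V)) powr (\<gamma> - 1)) * (M0 / (r * V))"
    by simp
  then show ?thesis
    unfolding entropy_density[OF assms] thrust_def using assms by (simp add: ac_simps)
qed

lemma sound_speed_eq_thrust:
  assumes "0 < r" "0 < V" "entropy r V = ka"
  shows "r * ((\<gamma> - 1) / 2 * (q_hat\<^sup>2 - V\<^sup>2)) powr (\<gamma> / (\<gamma> - 1)) = weight * thrust V"
proof -
  let ?\<rho> = "M0 / (r * V)"
  have pos: "0 < ?\<rho>" using assms M0_pos by simp
  have "(\<gamma> - 1) / 2 * (q_hat\<^sup>2 - V\<^sup>2) = \<gamma> * (ka * ?\<rho> powr (\<gamma> - 1))"
    using entropy_density[OF assms(1,2)] assms(3) gamma_gt_1 by simp
  then have "((\<gamma> - 1) / 2 * (q_hat\<^sup>2 - V\<^sup>2)) powr (\<gamma> / (\<gamma> - 1))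
      = \<gamma> powr (\<gamma> / (\<gamma> - 1)) * (ka powr (\<gamma> / (\<gamma> - 1)) * ?\<rho> powr \<gamma>)"
    using gamma_gt_1 ka_pos pos by (simp add: powr_mult powr_powr)
  also have "ka powr (\<gamma> / (\<gamma> - 1)) = ka powr (1 / (\<gamma> - 1)) * ka"
  proof -
    have "\<gamma> / (\<gamma> - 1) = 1 / (\<gamma> - 1) + 1" using gamma_gt_1 by (simp add: field_simps)
    then show ?thesis using ka_pos by (simp add: powr_add)
  qed
  finally have "r * ((\<gamma> - 1) / 2 * (q_hat\<^sup>2 - V\<^sup>2)) powr (\<gamma> / (\<gamma> - 1))
      = weight * (r * (entropy r V * ?\<rho> powr \<gamma>))"
    by (simp add: weight_def assms(3))
  then show ?thesis
    unfolding pressure_eq_thrust[OF assms(1,2)] .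
qed

lemma thrust_continuous: "continuous_on {0<..} thrust"
  unfolding thrust_def by (intro continuous_intros) auto

lemma thrust_sub_continuous: "continuous_on {a..} (\<lambda>r. thrust (V_sub r))"
  by (rule continuous_on_compose2[OF thrust_continuous V_sub_continuous]) (auto intro: V_sub)

lemma thrust_sup_continuous: "continuous_on {a..} (\<lambda>r. thrust (V_sup k0 r))"
  by (rule continuous_on_compose2[OF thrust_continuous V_sup_continuous]) (auto intro: V_sup)

lemma c_squared_shock_profile:
  assumes "\<eta> \<in> {a..R}" "a < norm x" "norm x < \<eta>"
  shows "c_squared (radial (shock_profile \<eta>)) x = (\<gamma> - 1) / 2 * (q_hat\<^sup>2 - (V_sub (norm x))\<^sup>2)"
proof -
  have "x \<noteq> 0" using assms a_pos by auto
  then have "norm (grad (radial (shock_profile \<eta>)) x) = \<bar>V_sub (norm x)\<bar>"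
    using shock_profile_deriv_interior(1)[OF assms] by (rule grad_radial)
  then show ?thesis by (simp add: c_squared_def)
qed

lemma J_eq:
  assumes \<eta>: "\<eta> \<in> {a..R}"
  shows "J \<eta> = 2 * pi * weight *
    (M0 * (phi_sup \<eta> - sub_potential \<eta>)
     - integral {a..\<eta>} (\<lambda>r. thrust (V_sub r)) - integral {\<eta>..R} (\<lambda>r. thrust (V_sup k0 r)))"
proof -
  let ?u = "radial (shock_profile \<eta>)"
  note Om = Omega_shock_profile[OF \<eta>]
  have sub_meas: "{x::plane. a < norm x \<and> norm x < \<eta>} \<in> sets borel"
    and sup_meas: "{x::plane. a < norm x \<and> \<eta> \<le> norm x \<and> norm x < R} \<in> sets borel"
    by measurable
  have behind: "(LINT x|lebesgue_on (Omega ?u). c_squared ?u x powr (\<gamma> / (\<gamma> - 1)))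
      = 2 * pi * (weight * integral {a..\<eta>} (\<lambda>r. thrust (V_sub r)))"
  proof -
    define f where "f r = ((\<gamma> - 1) / 2 * (q_hat\<^sup>2 - (V_sub r)\<^sup>2)) powr (\<gamma> / (\<gamma> - 1))" for r
    have "(LINT x|lebesgue_on (Omega ?u). c_squared ?u x powr (\<gamma> / (\<gamma> - 1)))
        = (LINT x|lebesgue_on {x::plane. a < norm x \<and> norm x < \<eta>}. f (norm x))"
      unfolding Om
      by (intro Bochner_Integration.integral_cong)
        (auto simp: f_def c_squared_shock_profile[OF \<eta>])
    also have "\<dots> = 2 * pi * integral {a..\<eta>} (\<lambda>r. r * f r)"
    proof (rule integral_radial_annulus)
      have "continuous_on {a..\<eta>} V_sub"
        using V_sub_continuous by (rule continuous_on_subset) auto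
      then show "continuous_on {a..\<eta>} f"
        unfolding f_def using gamma_gt_1 V_sub square_less_q_hat
        by (intro continuous_intros continuous_on_powr') (auto simp: less_imp_le)
    qed (use \<eta> a_pos sub_meas in auto)
    also have "integral {a..\<eta>} (\<lambda>r. r * f r) = integral {a..\<eta>} (\<lambda>r. weight * thrust (V_sub r))"
      using a_pos V_sub unfolding f_def by (intro integral_cong sound_speed_eq_thrust) auto
    finally show ?thesis by simp
  qed
  have ahead: "(LINT x|lebesgue_on (annulus - Omega ?u).
        \<gamma> powr (\<gamma> / (\<gamma> - 1)) * ka powr (1 / (\<gamma> - 1)) * p_sup (norm x))
      = 2 * pi * (weight * integral {\<eta>..R} (\<lambda>r. thrust (V_sup k0 r)))"
  proof -
    have diff: "annulus - Omega ?u = {x. a < norm x \<and> \<eta> \<le> norm x \<and> norm x < R}"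
      using \<eta> unfolding Om annulus_def by auto
    have p: "r * p_sup r = thrust (V_sup k0 r)" if "r \<in> {\<eta>..R}" for r
      using that \<eta> a_pos V_sup[of r] pressure_eq_thrust[of r "V_sup k0 r"]
      by (simp add: p_sup_def rho_sup_def)
    have "(LINT x|lebesgue_on (annulus - Omega ?u).
        \<gamma> powr (\<gamma> / (\<gamma> - 1)) * ka powr (1 / (\<gamma> - 1)) * p_sup (norm x))
      = 2 * pi * integral {\<eta>..R} (\<lambda>r. r * (\<gamma> powr (\<gamma> / (\<gamma> - 1)) * ka powr (1 / (\<gamma> - 1)) * p_sup r))"
      unfolding diff
    proof (rule integral_radial_annulus)
      have "continuous_on {\<eta>..R} (V_sup k0)"
        using V_sup_continuous by (rule continuous_on_subset) (use \<eta> in auto)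
      moreover have "0 < r \<and> 0 < V_sup k0 r" if "r \<in> {\<eta>..R}" for r
        using that \<eta> a_pos V_sup[of r] by auto
      ultimately show "continuous_on {\<eta>..R} (\<lambda>r. \<gamma> powr (\<gamma> / (\<gamma> - 1)) * ka powr (1 / (\<gamma> - 1)) * p_sup r)"
        unfolding p_sup_def rho_sup_def using M0_pos
        by (intro continuous_intros continuous_on_powr') force+
    qed (use \<eta> a_pos sup_meas in auto)
    also have "integral {\<eta>..R} (\<lambda>r. r * (\<gamma> powr (\<gamma> / (\<gamma> - 1)) * ka powr (1 / (\<gamma> - 1)) * p_sup r))
        = integral {\<eta>..R} (\<lambda>r. weight * thrust (V_sup k0 r))"
      by (intro integral_cong) (simp add: weight_def flip: p)
    finally show ?thesis by simp
  qed
  have "norm (a * cos t, a * sin t) = a" for t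
  proof -
    have "(a * cos t)\<^sup>2 + (a * sin t)\<^sup>2 = a\<^sup>2"
      by (simp add: power_mult_distrib flip: distrib_left)
    then show ?thesis using a_pos by (simp add: norm_Pair)
  qed
  then have boundary: "circle_integral a
      (\<lambda>x. \<gamma> powr (\<gamma> / (\<gamma> - 1)) * ka powr (1 / (\<gamma> - 1)) * (M0 / a) * ?u x)
      = 2 * pi * (weight * M0 * (phi_sup \<eta> - sub_potential \<eta>))"
    using a_pos \<eta> shock_profile_simps(1)[OF \<eta>, of a]
    by (simp add: circle_integral_def radial_def weight_def sub_potential_def
        set_lebesgue_integral_def)
  show ?thesis
    unfolding J_eq_I[OF \<eta>] I_def behind ahead boundary by (simp add: algebra_simps)
qed

text \<open>The scaled jump of the momentum flux, supersonic minus subsonic.  The formula makes sense and is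
  continuous up to both end points, so the one-sided limits of \<open>J'\<close> are its values there.\<close>

definition J_slope :: "real \<Rightarrow> real" where
  "J_slope \<eta> = 2 * pi * weight *
    ((thrust (V_sup k0 \<eta>) + M0 * V_sup k0 \<eta>) - (thrust (V_sub \<eta>) + M0 * V_sub \<eta>))"

lemma J_deriv:
  assumes \<eta>: "\<eta> \<in> {a<..<R}"
  shows "(J has_real_derivative J_slope \<eta>) (at \<eta>)"
proof -
  let ?F = "\<lambda>\<eta>. 2 * pi * weight *
    (M0 * (phi_sup \<eta> - sub_potential \<eta>)
     - integral {a..\<eta>} (\<lambda>r. thrust (V_sub r)) - integral {\<eta>..R} (\<lambda>r. thrust (V_sup k0 r)))"
  have \<eta>': "\<eta> \<in> {a..R}" using \<eta> by auto
  have cont: "continuous_on {a..R} (\<lambda>r. thrust (V_sub r))" "continuous_on {a..R} (\<lambda>r. thrust (V_sup k0 r))"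
    by (rule continuous_on_subset[OF thrust_sub_continuous] continuous_on_subset[OF thrust_sup_continuous]; auto)+
  have "(?F has_real_derivative 2 * pi * weight *
      (M0 * (V_sup k0 \<eta> - V_sub \<eta>) - thrust (V_sub \<eta>) - - thrust (V_sup k0 \<eta>))) (at \<eta> within {a..R})"
    by (intro DERIV_cmult DERIV_diff phi_sup_deriv sub_potential_deriv \<eta>'
        integral_has_real_derivative[OF cont(1) \<eta>'] integral_has_real_derivative'[OF cont(2) \<eta>'])
  then have "(?F has_real_derivative J_slope \<eta>) (at \<eta>)"
    using \<eta> by (simp add: at_within_Icc_at J_slope_def algebra_simps)
  then show ?thesis
  proof (rule has_field_derivative_transform_within_open)
    show "?F s = J s" if "s \<in> {a<..<R}" for s
      using that by (subst J_eq) auto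
  qed (use \<eta> in auto)
qed

lemma J_slope_continuous: "continuous_on {a..} J_slope"
  unfolding J_slope_def
  by (intro continuous_intros thrust_sub_continuous thrust_sup_continuous V_sub_continuous V_sup_continuous)

text \<open>Since \<open>thrust V + M0 V\<close> is a multiple of \<open>V + c\<^sub>*\<^sup>2 / V\<close>, its jump contains the factor
  \<open>V_sup - V_sub > 0\<close>, and the other factor is the deviation from the Prandtl relation.\<close>

lemma J_slope_factor:
  assumes "a \<le> \<eta>"
  obtains K where "0 < K" "J_slope \<eta> = K * (V_sub \<eta> * V_sup k0 \<eta> - c_star\<^sup>2)"
proof -
  let ?s = "V_sup k0 \<eta>" and ?t = "V_sub \<eta>"
  note sup = V_sup[OF assms] and sub = V_sub[OF assms]
  have momentum: "thrust V + M0 * V = M0 * (\<gamma> + 1) / (2 * \<gamma>) * (V + c_star\<^sup>2 / V)" if "0 < V" for V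
  proof -
    have "thrust V + M0 * V = M0 / (2 * \<gamma>) * (((\<gamma> - 1) * q_hat\<^sup>2 + (\<gamma> + 1) * V\<^sup>2) / V)"
      using that gamma_gt_1 by (simp add: thrust_def field_simps power2_eq_square)
    also have "\<dots> = M0 / (2 * \<gamma>) * (((\<gamma> + 1) * c_star\<^sup>2 + (\<gamma> + 1) * V\<^sup>2) / V)"
      unfolding c_star_sq ..
    also have "\<dots> = M0 * (\<gamma> + 1) / (2 * \<gamma>) * (V + c_star\<^sup>2 / V)"
      using that gamma_gt_1 by (simp add: field_simps power2_eq_square)
    finally show ?thesis .
  qed
  define K where "K = 2 * pi * weight * (M0 * (\<gamma> + 1) / (2 * \<gamma>)) * ((?s - ?t) / (?s * ?t))"
  have "0 < K"
    unfolding K_def using weight_pos M0_pos gamma_gt_1 sup sub by simp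
  moreover have "(?s + c_star\<^sup>2 / ?s) - (?t + c_star\<^sup>2 / ?t) = (?s - ?t) / (?s * ?t) * (?t * ?s - c_star\<^sup>2)"
    using sup sub by (simp add: field_simps power2_eq_square)
  then have "J_slope \<eta> = K * (?t * ?s - c_star\<^sup>2)"
    unfolding J_slope_def K_def momentum[OF sup(4)] momentum[OF sub(1)]
    by (simp only: mult.assoc flip: right_diff_distrib)
  ultimately show thesis by (rule that)
qed

lemma J_slope_sign:
  assumes "a \<le> \<eta>"
  shows "J_slope \<eta> \<le> 0 \<longleftrightarrow> V_sub \<eta> * V_sup k0 \<eta> \<le> c_star\<^sup>2"
    and "J_slope \<eta> < 0 \<longleftrightarrow> V_sub \<eta> * V_sup k0 \<eta> < c_star\<^sup>2"
proof -
  obtain K where "0 < K" "J_slope \<eta> = K * (V_sub \<eta> * V_sup k0 \<eta> - c_star\<^sup>2)"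
    using J_slope_factor[OF assms] .
  then show "J_slope \<eta> \<le> 0 \<longleftrightarrow> V_sub \<eta> * V_sup k0 \<eta> \<le> c_star\<^sup>2"
    and "J_slope \<eta> < 0 \<longleftrightarrow> V_sub \<eta> * V_sup k0 \<eta> < c_star\<^sup>2"
    by (simp_all add: mult_le_0_iff mult_less_0_iff)
qed

lemma J_slope_single_crossing:
  assumes "a \<le> r" "r < s" "J_slope r \<le> 0"
  shows "J_slope s < 0"
  using prandtl_single_crossing[of r s] J_slope_sign(1)[of r] J_slope_sign(2)[of s] assms by simp

section \<open>Transonic solutions as maximisers\<close>

lemma shock_profile_transonic:
  assumes "\<eta> \<in> {a<..<R}"
  shows "transonic_at \<eta> (shock_profile \<eta>)"
proof -
  have "\<eta> \<in> {a..R}" using assms by auto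
  note deriv = shock_profile_deriv_interior[OF this]
  have "\<exists>V. (shock_profile \<eta> has_real_derivative V) (at r) \<and> V < c_star" if "r \<in> {a<..<\<eta>}" for r
    using that deriv(1)[of r] V_sub(2)[of r] by auto
  moreover have "\<exists>V. (shock_profile \<eta> has_real_derivative V) (at r) \<and> V > c_star" if "r \<in> {\<eta><..<R}" for r
    using that assms deriv(2)[of r] V_sup(1)[of r] by auto
  ultimately show ?thesis
    using assms by (simp add: transonic_at_def)
qed

lemma transonic_solution_iff:
  "transonic_solution \<phi> \<longleftrightarrow> (\<exists>\<eta>\<in>{a<..<R}. \<phi> = shock_profile \<eta> \<and> (\<forall>s\<in>{a<..<R}. J s \<le> J \<eta>))"
proof -
  have attained: "ereal (J \<eta>) = sup_min \<longleftrightarrow> (\<forall>s\<in>{a<..<R}. J s \<le> J \<eta>)" if "\<eta> \<in> {a<..<R}" for \<eta>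
  proof
    assume "ereal (J \<eta>) = sup_min"
    then show "\<forall>s\<in>{a<..<R}. J s \<le> J \<eta>"
      unfolding sup_min_eq_SUP_J by (metis SUP_upper ereal_less_eq(3))
  next
    assume "\<forall>s\<in>{a<..<R}. J s \<le> J \<eta>"
    then have "(SUP s\<in>{a<..<R}. ereal (J s)) = ereal (J \<eta>)"
      using that by (intro SUP_eqI) auto
    then show "ereal (J \<eta>) = sup_min"
      unfolding sup_min_eq_SUP_J by simp
  qed
  have "transonic_solution \<phi> \<longleftrightarrow> (\<exists>\<eta>\<in>{a<..<R}. \<phi> \<in> K1_at \<eta> \<and> transonic_at \<eta> \<phi> \<and>
     (\<forall>\<psi>\<in>K1_at \<eta>. I (radial \<phi>) \<le> I (radial \<psi>)) \<and> ereal (I (radial \<phi>)) = sup_min)"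
    by (auto simp: transonic_solution_def transonic_at_def)
  also have "\<dots> \<longleftrightarrow> (\<exists>\<eta>\<in>{a<..<R}. \<phi> = shock_profile \<eta> \<and> ereal (J \<eta>) = sup_min)"
    by (intro bex_cong refl) (auto simp: K1_at_eq J_eq_I shock_profile_transonic)
  finally show ?thesis using attained by auto
qed

text \<open>Between two shock positions the profile with the outer shock lies strictly above \<open>phi_sup\<close>,
  while the other one coincides with it.\<close>

lemma shock_profile_inj:
  assumes "\<eta> \<in> {a..R}" "\<xi> \<in> {a..R}" "shock_profile \<eta> = shock_profile \<xi>"
  shows "\<eta> = \<xi>"
proof -
  have "\<not> s < t" if "s \<in> {a..R}" "t \<in> {a..R}" "shock_profile s = shock_profile t" for s t
  proof
    assume "s < t"
    define r where "r = (s + t) / 2"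
    have r: "s < r" "r < t" using \<open>s < t\<close> by (auto simp: r_def)
    then have "phi_sup r < shock_profile t r"
      using that by (intro shock_profile_above_phi_sup) auto
    moreover have "shock_profile s r = phi_sup r"
      using r that by (intro shock_profile_simps) auto
    ultimately show False using that by simp
  qed
  then show ?thesis using assms by (metis linorder_less_linear)
qed

lemma transonic_solution_ex1_iff:
  "(\<exists>!\<phi>. transonic_solution \<phi>) \<longleftrightarrow> (\<exists>!\<eta>. \<eta> \<in> {a<..<R} \<and> (\<forall>s\<in>{a<..<R}. J s \<le> J \<eta>))"
  (is "?L \<longleftrightarrow> (\<exists>!\<eta>. ?M \<eta>)")
proof
  assume ?L
  then obtain \<eta> where \<eta>: "?M \<eta>" and uniq: "\<And>\<psi>. transonic_solution \<psi> \<Longrightarrow> \<psi> = shock_profile \<eta>"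
    unfolding transonic_solution_iff by blast
  show "\<exists>!\<eta>. ?M \<eta>"
  proof (rule ex1I[of _ \<eta>])
    fix \<xi> assume \<xi>: "?M \<xi>"
    then have "shock_profile \<xi> = shock_profile \<eta>"
      by (intro uniq) (auto simp: transonic_solution_iff)
    then show "\<xi> = \<eta>" using \<xi> \<eta> by (intro shock_profile_inj) auto
  qed (fact \<eta>)
next
  assume "\<exists>!\<eta>. ?M \<eta>"
  then show ?L unfolding transonic_solution_iff by blast
qed

text \<open>Single crossing does all the work.  A maximiser \<open>\<eta>\<close> has slope zero, which makes the slope negative
  to its right and, because a nonpositive slope at \<open>a\<close> would make it negative at \<open>\<eta>\<close>, positive at
  \<open>a\<close>.  Conversely the intermediate value theorem supplies the zero.\<close>

lemma unique_maximizer_iff_slopes: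
  "(\<exists>!\<eta>. \<eta> \<in> {a<..<R} \<and> (\<forall>s\<in>{a<..<R}. J s \<le> J \<eta>)) \<longleftrightarrow> J_slope R < 0 \<and> 0 < J_slope a"
proof
  assume "\<exists>!\<eta>. \<eta> \<in> {a<..<R} \<and> (\<forall>s\<in>{a<..<R}. J s \<le> J \<eta>)"
  then obtain \<eta> where \<eta>: "\<eta> \<in> {a<..<R}" and max: "\<And>s. s \<in> {a<..<R} \<Longrightarrow> J s \<le> J \<eta>"
    by blast
  have "J_slope \<eta> = 0"
  proof (rule DERIV_local_max[OF J_deriv[OF \<eta>]])
    show "0 < min (\<eta> - a) (R - \<eta>)" using \<eta> by simp
    show "\<forall>y. \<bar>\<eta> - y\<bar> < min (\<eta> - a) (R - \<eta>) \<longrightarrow> J y \<le> J \<eta>"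
      by (intro allI impI max) auto
  qed
  then show "J_slope R < 0 \<and> 0 < J_slope a"
    using \<eta> J_slope_single_crossing[of \<eta> R] J_slope_single_crossing[of a \<eta>] by force
next
  assume slopes: "J_slope R < 0 \<and> 0 < J_slope a"
  have "continuous_on {a..R} J_slope"
    using J_slope_continuous by (rule continuous_on_subset) auto
  then obtain \<eta> where \<eta>: "a \<le> \<eta>" "\<eta> \<le> R" "J_slope \<eta> = 0"
    using IVT2'[of J_slope R 0 a] slopes a_less_R by auto
  then have \<eta>': "\<eta> \<in> {a<..<R}" using slopes by (cases "\<eta> = a"; cases "\<eta> = R") auto
  have less: "J s < J \<eta>" if s: "s \<in> {a<..<R}" "s \<noteq> \<eta>" for s
  proof (cases "s < \<eta>")
    case True
    have pos: "0 < J_slope r" if "s < r" "r < \<eta>" for r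
      using that s \<eta> J_slope_single_crossing[of r \<eta>] by force
    show ?thesis
    proof (rule DERIV_pos_imp_increasing_open[OF True])
      show "\<exists>y. (J has_real_derivative y) (at r) \<and> 0 < y" if "s < r" "r < \<eta>" for r
        using that s \<eta>' pos[OF that] by (intro exI[of _ "J_slope r"] conjI J_deriv) auto
      show "continuous_on {s..\<eta>} J"
        using s \<eta>' by (intro continuous_at_imp_continuous_on ballI DERIV_isCont[OF J_deriv]) auto
    qed
  next
    case False
    then have "\<eta> < s" using s by simp
    then show ?thesis
    proof (rule DERIV_neg_imp_decreasing_open)
      show "\<exists>y. (J has_real_derivative y) (at r) \<and> y < 0" if "\<eta> < r" "r < s" for r
        using that s \<eta> J_slope_single_crossing[of \<eta> r]
        by (intro exI[of _ "J_slope r"] conjI J_deriv) auto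
      show "continuous_on {\<eta>..s} J"
        using s \<eta>' by (intro continuous_at_imp_continuous_on ballI DERIV_isCont[OF J_deriv]) auto
    qed
  qed
  show "\<exists>!\<eta>. \<eta> \<in> {a<..<R} \<and> (\<forall>s\<in>{a<..<R}. J s \<le> J \<eta>)"
  proof (rule ex1I[of _ \<eta>])
    show "\<eta> \<in> {a<..<R} \<and> (\<forall>s\<in>{a<..<R}. J s \<le> J \<eta>)"
      using \<eta>' less by (metis less_eq_real_def)
    show "\<xi> = \<eta>" if "\<xi> \<in> {a<..<R} \<and> (\<forall>s\<in>{a<..<R}. J s \<le> J \<xi>)" for \<xi>
      using that less[of \<xi>] \<eta>' by force
  qed
qed

lemma J_slope_limits:
  assumes "\<And>\<eta>. \<eta> \<in> {a<..<R} \<Longrightarrow> J' \<eta> = J_slope \<eta>"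
  shows "(J' \<longlongrightarrow> J_slope R) (at_left R)" "(J' \<longlongrightarrow> J_slope a) (at_right a)"
proof -
  have cont: "continuous_on {a..R} J_slope"
    using J_slope_continuous by (rule continuous_on_subset) auto
  have lim_R: "(J_slope \<longlongrightarrow> J_slope R) (at_left R)" and lim_a: "(J_slope \<longlongrightarrow> J_slope a) (at_right a)"
    using cont a_less_R by (auto simp: continuous_on_Icc_at_leftD continuous_on_Icc_at_rightD)
  have "\<forall>\<^sub>F \<eta> in at_left R. J_slope \<eta> = J' \<eta>"
    by (rule eventually_at_leftI[of a]) (use assms a_less_R in auto)
  with lim_R show "(J' \<longlongrightarrow> J_slope R) (at_left R)"
    by (rule Lim_transform_eventually)
  have "\<forall>\<^sub>F \<eta> in at_right a. J_slope \<eta> = J' \<eta>"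
    by (rule eventually_at_rightI[of _ R]) (use assms a_less_R in auto)
  with lim_a show "(J' \<longlongrightarrow> J_slope a) (at_right a)"
    by (rule Lim_transform_eventually)
qed

lemma one_sided_slopes_iff:
  "(\<exists>J' l_a l_R. (\<forall>\<eta>\<in>{a<..<R}. (J has_real_derivative J' \<eta>) (at \<eta>)) \<and>
      (J' \<longlongrightarrow> l_R) (at_left R) \<and> (J' \<longlongrightarrow> l_a) (at_right a) \<and> l_R < 0 \<and> l_a > 0)
    \<longleftrightarrow> J_slope R < 0 \<and> 0 < J_slope a"
proof
  assume "\<exists>J' l_a l_R. (\<forall>\<eta>\<in>{a<..<R}. (J has_real_derivative J' \<eta>) (at \<eta>)) \<and>
      (J' \<longlongrightarrow> l_R) (at_left R) \<and> (J' \<longlongrightarrow> l_a) (at_right a) \<and> l_R < 0 \<and> l_a > 0"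
  then obtain J' l_a l_R where J': "\<And>\<eta>. \<eta> \<in> {a<..<R} \<Longrightarrow> (J has_real_derivative J' \<eta>) (at \<eta>)"
    and lim: "(J' \<longlongrightarrow> l_R) (at_left R)" "(J' \<longlongrightarrow> l_a) (at_right a)" and sign: "l_R < 0" "l_a > 0"
    by blast
  have "J' \<eta> = J_slope \<eta>" if "\<eta> \<in> {a<..<R}" for \<eta>
    using J'[OF that] J_deriv[OF that] by (rule DERIV_unique)
  note slopes = J_slope_limits[OF this]
  have "l_R = J_slope R" "l_a = J_slope a"
    using tendsto_unique[OF _ lim(1) slopes(1)] tendsto_unique[OF _ lim(2) slopes(2)] by auto
  then show "J_slope R < 0 \<and> 0 < J_slope a" using sign by simp
next
  assume "J_slope R < 0 \<and> 0 < J_slope a"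
  then show "\<exists>J' l_a l_R. (\<forall>\<eta>\<in>{a<..<R}. (J has_real_derivative J' \<eta>) (at \<eta>)) \<and>
      (J' \<longlongrightarrow> l_R) (at_left R) \<and> (J' \<longlongrightarrow> l_a) (at_right a) \<and> l_R < 0 \<and> l_a > 0"
    using J_slope_limits[OF refl] J_deriv
    by (intro exI[of _ J_slope] exI[of _ "J_slope a"] exI[of _ "J_slope R"]) simp
qed

end

theorem theorem5p1:
  fixes \<gamma> a R v0 va \<rho>0 k0 :: real
  assumes "radial_model \<gamma> a R v0 va \<rho>0 k0"
  shows "radial_data.sup_min \<gamma> a R v0 va \<rho>0 k0
           = (SUP \<eta>\<in>{a<..<R}. ereal (radial_data.J \<gamma> a R v0 va \<rho>0 k0 \<eta>)) \<and>
         ((\<exists>!\<phi>. radial_data.transonic_solution \<gamma> a R v0 va \<rho>0 k0 \<phi>) \<longleftrightarrow>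
          (\<exists>J' l_a l_R.
             (\<forall>\<eta>\<in>{a<..<R}. (radial_data.J \<gamma> a R v0 va \<rho>0 k0 has_real_derivative J' \<eta>) (at \<eta>)) \<and>
             (J' \<longlongrightarrow> l_R) (at_left R) \<and> (J' \<longlongrightarrow> l_a) (at_right a) \<and>
             l_R < 0 \<and> l_a > 0))"
proof -
  interpret radial_model \<gamma> a R v0 va \<rho>0 k0 by fact
  show ?thesis
    unfolding one_sided_slopes_iff transonic_solution_ex1_iff unique_maximizer_iff_slopes
    using sup_min_eq_SUP_J by simp
qed

end
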